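(* Let $G$ be a bicyclic graph of order $n$. Then $EE(G)\le EE(\mathbf{G}_1)$, where $\mathbf{G}_1$ is the bicyclic graph of order $n$ obtained from $\theta(2,2,1)$ by attaching $n-4$ pendant edges to one of its vertices of degree $3$. Equality holds if and only if $G=\mathbf{G}_1$ (i.e. $G$ is isomorphic to $\mathbf{G}_1$).
   Context: All graphs are finite and simple. The Estrada index of a graph $G$ of order $n$ (i.e. with $n$ vertices) is $EE(G)=\sum_{i=1}^n e^{\lambda_i(G)}$, where $\lambda_1(G)\ge\cdots\ge\lambda_n(G)$ are the eigenvalues (with multiplicity) of the adjacency matrix of $G$. A bicyclic graph is a connected simple graph $G=(V,E)$ with $|E|=|V|+1$ (so necessarily $|V|\ge 4$). For integers $p,q,l\ge 1$, at most one of which equals $1$, $\theta(p,q,l)$ is the union of three internally disjoint paths of lengths (numbers of edges) $p,q,l$ with common end vertices; thus $\theta(2,2,1)$ is the complete graph $K_4$ minus one edge. Attaching a pendant edge at a vertex $x$ means adding one new vertex adjacent only to $x$. *)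

theory Defs
  imports
    Complex_Main
    "Graph_Theory.Graph_Theory"
    "Jordan_Normal_Form.Char_Poly"
    "HOL-Computational_Algebra.Fundamental_Theorem_Algebra"
begin

text \<open>
  Finite simple graphs are the symmetric, loop-free digraphs without parallel arcs of the locale
  \<^locale>\<open>graph\<close>. An edge is thus a pair of opposite arcs, and the set of undirected edges has to be
  recovered from the arcs.
\<close>

definition uedges :: "('a, 'b) pre_digraph \<Rightarrow> 'a set set" where
  "uedges G = (\<lambda>e. {tail G e, head G e}) ` arcs G"

definition bicyclic :: "('a, 'b) pre_digraph \<Rightarrow> bool" where
  "bicyclic G \<longleftrightarrow> graph G \<and> connected G \<and> card (uedges G) = card (verts G) + 1"

text \<open>
  The rows of the adjacency matrix follow an arbitrary enumeration of the vertices; a different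
  enumeration conjugates the matrix by a permutation and leaves the spectrum unchanged.
\<close>

definition vertex_list :: "('a, 'b) pre_digraph \<Rightarrow> 'a list" where
  "vertex_list G = (SOME vs. distinct vs \<and> set vs = verts G)"

definition adjacency_mat :: "('a, 'b) pre_digraph \<Rightarrow> real mat" where
  "adjacency_mat G = mat (card (verts G)) (card (verts G))
     (\<lambda>(i, j). if vertex_list G ! i \<rightarrow>\<^bsub>G\<^esub> vertex_list G ! j then 1 else 0)"

definition graph_eigenvalues :: "('a, 'b) pre_digraph \<Rightarrow> real multiset" where
  "graph_eigenvalues G = proots (char_poly (adjacency_mat G))"

text \<open>
  \<open>proots\<close> only collects the real roots of the characteristic polynomial; as the adjacency matrix is
  symmetric, these are all of them, and the multiset has as many elements as the graph has vertices.
\<close>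

lemma size_proots_real_rooted:
  fixes p :: "real poly"
  assumes "p \<noteq> 0" and "\<And>z. poly (map_poly complex_of_real p) z = 0 \<Longrightarrow> z \<in> \<real>"
  shows "size (proots p) = degree p"
  using assms
proof (induction "degree p" arbitrary: p)
  case 0
  then obtain c where "p = [:c:]" by (metis degree_eq_zeroE)
  then show ?case using 0 by simp
next
  case (Suc d)
  have "degree (map_poly complex_of_real p) \<noteq> 0" using Suc.hyps by simp
  then obtain z where z: "poly (map_poly complex_of_real p) z = 0"
    using alg_closed_imp_poly_has_root[of "map_poly complex_of_real p"] by auto
  then obtain r where r: "z = complex_of_real r" using Suc.prems(2) Reals_cases by blast
  then have "poly p r = 0" using z by simp
  then obtain q where q: "p = [:-r, 1:] * q" by (metis poly_eq_0_iff_dvd dvdE)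
  have q0: "q \<noteq> 0" using q Suc.prems by auto
  have dq: "degree p = Suc (degree q)" unfolding q using q0 by (subst degree_mult_eq) auto
  have "map_poly complex_of_real p = map_poly complex_of_real [:-r, 1:] * map_poly complex_of_real q"
    unfolding q by (rule poly_eqI) (simp only: coeff_map_poly coeff_mult of_real_0 of_real_sum of_real_mult)
  then have "size (proots q) = degree q"
    using Suc.prems(2) Suc.hyps(2) dq q0 by (intro Suc.hyps(1)) auto
  then show ?case using q0 dq unfolding q by (subst proots_mult) auto
qed

lemma size_proots_char_poly_symmetric:
  fixes A :: "real mat"
  assumes A: "A \<in> carrier_mat n n" and sym: "\<And>i j. i < n \<Longrightarrow> j < n \<Longrightarrow> A $$ (i, j) = A $$ (j, i)"
  shows "size (proots (char_poly A)) = n"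
proof -
  let ?C = "map_mat complex_of_real A"
  have C: "?C \<in> carrier_mat n n" using A by simp
  have "z \<in> \<real>" if "poly (map_poly complex_of_real (char_poly A)) z = 0" for z
  proof -
    have "char_poly ?C = map_poly complex_of_real (char_poly A)"
      by (rule of_real_hom.char_poly_hom[OF A])
    then have "eigenvalue ?C z"
      using that eigenvalue_root_char_poly[OF C] by simp
    then obtain v where v: "v \<in> carrier_vec n" "v \<noteq> 0\<^sub>v n" "?C *\<^sub>v v = z \<cdot>\<^sub>v v"
      unfolding eigenvalue_def eigenvector_def using C by auto
    have row: "(\<Sum>j<n. of_real (A $$ (i, j)) * v $ j) = z * v $ i" if "i < n" for i
    proof -
      have "(?C *\<^sub>v v) $ i = (\<Sum>j<n. of_real (A $$ (i, j)) * v $ j)"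
        using that A v(1) by (auto simp: scalar_prod_def atLeast0LessThan intro!: sum.cong)
      then show ?thesis using v that by simp
    qed
    define s where "s = (\<Sum>i<n. cnj (v $ i) * (v $ i))"
    define t where "t = (\<Sum>i<n. \<Sum>j<n. cnj (v $ i) * of_real (A $$ (i, j)) * v $ j)"
    have t: "t = z * s"
      unfolding t_def s_def sum_distrib_left
    proof (rule sum.cong[OF refl])
      fix i assume "i \<in> {..<n}"
      then show "(\<Sum>j<n. cnj (v $ i) * of_real (A $$ (i, j)) * v $ j) = z * (cnj (v $ i) * v $ i)"
        using row[of i] by (simp add: mult.assoc sum_distrib_left[symmetric] mult.left_commute)
    qed
    have "cnj t = (\<Sum>i<n. \<Sum>j<n. v $ i * of_real (A $$ (i, j)) * cnj (v $ j))"
      unfolding t_def by simp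
    also have "\<dots> = (\<Sum>j<n. \<Sum>i<n. v $ i * of_real (A $$ (i, j)) * cnj (v $ j))"
      by (rule sum.swap)
    also have "\<dots> = t"
      unfolding t_def using sym by (intro sum.cong refl) (auto simp: mult_ac)
    finally have tr: "cnj t = t" .
    have s: "s = of_real (\<Sum>i<n. (cmod (v $ i))\<^sup>2)"
      unfolding s_def of_real_sum complex_norm_square by (simp only: mult.commute)
    obtain k where k: "k < n" "v $ k \<noteq> 0" using v(1,2) by (metis carrier_vecD dim_vec eq_vecI index_zero_vec(1) zero_vec_def)
    have "(cmod (v $ k))\<^sup>2 \<le> (\<Sum>i<n. (cmod (v $ i))\<^sup>2)"
      by (rule member_le_sum) (use k in auto)
    moreover have "0 < (cmod (v $ k))\<^sup>2" using k(2) by simp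
    ultimately have "s \<noteq> 0" unfolding s by (smt (verit) of_real_eq_0_iff)
    have "cnj z * s = z * s" using tr t s by (metis complex_cnj_complex_of_real complex_cnj_mult)
    with \<open>s \<noteq> 0\<close> have "cnj z = z" by simp
    then show ?thesis by (simp add: Reals_cnj_iff)
  qed
  moreover have "char_poly A \<noteq> 0" "degree (char_poly A) = n"
    using degree_monic_char_poly[OF A] by auto
  ultimately show ?thesis using size_proots_real_rooted by metis
qed
lemma size_graph_eigenvalues:
  assumes "graph G"
  shows "size (graph_eigenvalues G) = card (verts G)"
proof -
  interpret graph G by fact
  have "u \<rightarrow>\<^bsub>G\<^esub> v \<longleftrightarrow> v \<rightarrow>\<^bsub>G\<^esub> u" for u v
    using sym_arcs by (auto dest: arcs_ends_symmetric)
  then show ?thesis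
    unfolding graph_eigenvalues_def
    by (intro size_proots_char_poly_symmetric) (simp_all add: adjacency_mat_def)
qed

definition estrada_index :: "('a, 'b) pre_digraph \<Rightarrow> real" where
  "estrada_index G = (\<Sum>x\<in>#graph_eigenvalues G. exp x)"

text \<open>
  The graph \<open>\<theta>(p,q,l)\<close> is meant for \<open>p, q, l \<ge> 1\<close>, at most one of them equal to \<open>1\<close>.
  The \<open>k\<close>-th vertex of the \<open>i\<close>-th path is its start \<open>Source\<close> for \<open>k = 0\<close>, its end \<open>Sink\<close> for \<open>k\<close> the
  length \<open>m\<close> of the path, and otherwise a vertex private to that path.
\<close>

datatype theta_vertex = Source | Sink | Inner nat nat

definition theta_path_vertex :: "nat \<Rightarrow> nat \<Rightarrow> nat \<Rightarrow> theta_vertex" where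
  "theta_path_vertex i m k = (if k = 0 then Source else if k = m then Sink else Inner i k)"

definition path_verts :: "(nat \<Rightarrow> 'a) \<Rightarrow> nat \<Rightarrow> 'a set" where
  "path_verts w m = w ` {..m}"

definition path_arcs :: "(nat \<Rightarrow> 'a) \<Rightarrow> nat \<Rightarrow> 'a rel" where
  "path_arcs w m = (\<Union>k<m. {(w k, w (Suc k)), (w (Suc k), w k)})"

definition theta :: "nat \<Rightarrow> nat \<Rightarrow> nat \<Rightarrow> theta_vertex pair_pre_digraph" where
  "theta p q l = \<lparr>
     pverts = path_verts (theta_path_vertex 0 p) p \<union> path_verts (theta_path_vertex 1 q) q
       \<union> path_verts (theta_path_vertex 2 l) l,
     parcs = path_arcs (theta_path_vertex 0 p) p \<union> path_arcs (theta_path_vertex 1 q) q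
       \<union> path_arcs (theta_path_vertex 2 l) l\<rparr>"

definition attach_pendants :: "'a pair_pre_digraph \<Rightarrow> 'a \<Rightarrow> nat \<Rightarrow> ('a + nat) pair_pre_digraph" where
  "attach_pendants G x k = \<lparr>
     pverts = Inl ` pverts G \<union> Inr ` {..<k},
     parcs = (\<lambda>(u, v). (Inl u, Inl v)) ` parcs G \<union> (\<Union>i<k. {(Inl x, Inr i), (Inr i, Inl x)})\<rparr>"

definition G1 :: "theta_vertex \<Rightarrow> nat \<Rightarrow> (theta_vertex + nat) pair_pre_digraph" where
  "G1 x n = attach_pendants (theta 2 2 1) x (n - 4)"

lemma pverts_theta_2_2_1: "pverts (theta 2 2 1) = {Source, Sink, Inner 0 1, Inner 1 1}"
  by (auto simp: theta_def path_verts_def theta_path_vertex_def atMost_nat_numeral atMost_Suc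
      numeral_2_eq_2)

lemma parcs_theta_2_2_1:
  "parcs (theta 2 2 1) = {(Source, Sink), (Sink, Source), (Source, Inner 1 1),
     (Inner 1 1, Source), (Inner 1 1, Sink), (Sink, Inner 1 1), (Source, Inner 0 1),
     (Inner 0 1, Source), (Inner 0 1, Sink), (Sink, Inner 0 1)}"
proof -
  have "path_arcs (theta_path_vertex 0 2) 2 = {(Source, Inner 0 1), (Inner 0 1, Source),
      (Inner 0 1, Sink), (Sink, Inner 0 1)}"
    by (simp add: path_arcs_def theta_path_vertex_def lessThan_Suc numeral_2_eq_2 insert_commute)
  moreover have "path_arcs (theta_path_vertex 1 2) 2 = {(Source, Inner 1 1), (Inner 1 1, Source),
      (Inner 1 1, Sink), (Sink, Inner 1 1)}"
    by (simp add: path_arcs_def theta_path_vertex_def lessThan_Suc numeral_2_eq_2 insert_commute)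
  moreover have "path_arcs (theta_path_vertex 2 1) 1 = {(Source, Sink), (Sink, Source)}"
    by (simp add: path_arcs_def theta_path_vertex_def lessThan_Suc)
  ultimately show ?thesis
    by (simp add: theta_def)
qed

lemma theta_2_2_1_is_K4_minus_edge:
  "parcs (theta 2 2 1) = pverts (theta 2 2 1) \<times> pverts (theta 2 2 1) - Id
     - {(Inner 0 1, Inner 1 1), (Inner 1 1, Inner 0 1)}"
  unfolding pverts_theta_2_2_1 parcs_theta_2_2_1
  by (rule equalityI; rule subsetI; elim DiffE SigmaE insertE emptyE; simp)

text \<open>In a symmetric digraph the out-degree of a vertex is its degree as a vertex of a graph.\<close>

lemma out_degree_theta_2_2_1:
  assumes "x \<in> verts (theta 2 2 1)"
  shows "out_degree (theta 2 2 1) x = 3 \<longleftrightarrow> x \<in> {Source, Sink}"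
proof -
  have deg: "out_degree (theta 2 2 1) y = card {e \<in> parcs (theta 2 2 1). fst e = y}" for y
    by (simp add: out_degree_def out_arcs_def)
  have filter_insert: "{e \<in> insert a A. P e} = (if P a then insert a {e \<in> A. P e} else {e \<in> A. P e})"
    for a :: "theta_vertex \<times> theta_vertex" and A P by auto
  have "out_degree (theta 2 2 1) Source = 3" "out_degree (theta 2 2 1) Sink = 3"
    "out_degree (theta 2 2 1) (Inner 0 1) = 2" "out_degree (theta 2 2 1) (Inner 1 1) = 2"
    unfolding deg parcs_theta_2_2_1 by (simp_all only: filter_insert) simp_all
  moreover have "x = Source \<or> x = Sink \<or> x = Inner 0 1 \<or> x = Inner 1 1"
    using assms unfolding with_proj_simps pverts_theta_2_2_1 by simp
  ultimately show ?thesis by (elim disjE) simp_all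
qed

lemma bicyclic_G1:
  assumes x: "x \<in> {Source, Sink}" and n: "n \<ge> 4"
  shows "bicyclic (G1 x n)" and "card (verts (G1 x n)) = n"
proof -
  let ?H = "with_proj (G1 x n)"
  have V: "pverts (G1 x n) = Inl ` {Source, Sink, Inner 0 1, Inner 1 1} \<union> Inr ` {..<n - 4}"
    unfolding G1_def attach_pendants_def pverts_theta_2_2_1 by simp
  have A: "parcs (G1 x n) = {(Inl Source, Inl Sink), (Inl Sink, Inl Source),
      (Inl Source, Inl (Inner 1 1)), (Inl (Inner 1 1), Inl Source),
      (Inl (Inner 1 1), Inl Sink), (Inl Sink, Inl (Inner 1 1)),
      (Inl Source, Inl (Inner 0 1)), (Inl (Inner 0 1), Inl Source),
      (Inl (Inner 0 1), Inl Sink), (Inl Sink, Inl (Inner 0 1))}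
      \<union> (\<Union>i<n - 4. {(Inl x, Inr i), (Inr i, Inl x)})"
    unfolding G1_def attach_pendants_def parcs_theta_2_2_1 by simp
  have "card (pverts (G1 x n)) = card (Inl ` {Source, Sink, Inner 0 1, Inner 1 1} :: (theta_vertex + nat) set)
      + card (Inr ` {..<n - 4} :: (theta_vertex + nat) set)"
    unfolding V by (rule card_Un_disjoint) auto
  also have "\<dots> = n" using n by (simp add: card_image)
  finally have card_V: "card (pverts (G1 x n)) = n" .
  then show "card (verts ?H) = n" by simp
  have fin: "finite (pverts (G1 x n))" "finite (parcs (G1 x n))" unfolding V A by auto
  have sym: "sym (parcs (G1 x n))" unfolding A
    by (rule symI) (elim UnE UN_E insertE emptyE; auto)
  have arc: "u \<in> pverts (G1 x n) \<and> v \<in> pverts (G1 x n) \<and> u \<noteq> v" if "(u, v) \<in> parcs (G1 x n)" for u v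
    using that x unfolding V A by (elim UnE UN_E insertE emptyE) auto
  interpret H: pair_graph "G1 x n"
  proof unfold_locales
    fix e assume "e \<in> parcs (G1 x n)"
    then show "fst e \<in> pverts (G1 x n)" "snd e \<in> pverts (G1 x n)" "fst e \<noteq> snd e"
      using arc[of "fst e" "snd e"] by simp_all
  next
    show "symmetric ?H" using sym by (simp add: symmetric_def)
  qed (fact fin)+
  have graph: "graph ?H" by unfold_locales
  define S where "S = {(Inl Source, Inl Sink), (Inl Source, Inl (Inner 0 1)),
      (Inl Source, Inl (Inner 1 1)), (Inl Sink, Inl (Inner 0 1)), (Inl Sink, Inl (Inner 1 1))}
      \<union> (\<lambda>i. (Inl x :: theta_vertex + nat, Inr i :: theta_vertex + nat)) ` {..<n - 4}"
  have parcs_S: "parcs (G1 x n) = S \<union> S\<inverse>"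
  proof (rule equalityI)
    show "parcs (G1 x n) \<subseteq> S \<union> S\<inverse>"
      unfolding A S_def by (rule subsetI) (elim UnE UN_E insertE emptyE; simp)
    show "S \<union> S\<inverse> \<subseteq> parcs (G1 x n)"
      unfolding A S_def
      by (rule subsetI) (elim UnE converseE insertE emptyE imageE; simp)
  qed
  have "(\<lambda>e. {fst e, snd e}) ` (S\<inverse>) = (\<lambda>e. {fst e, snd e}) ` S"
    by (force simp: insert_commute image_iff)
  then have "uedges ?H = (\<lambda>e. {fst e, snd e}) ` S"
    unfolding uedges_def with_proj_simps parcs_S image_Un by simp
  also have "\<dots> = {{Inl Source, Inl Sink}, {Inl Source, Inl (Inner 0 1)},
      {Inl Source, Inl (Inner 1 1)}, {Inl Sink, Inl (Inner 0 1)}, {Inl Sink, Inl (Inner 1 1)}}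
      \<union> (\<lambda>i. {Inl x, Inr i}) ` {..<n - 4}" (is "_ = ?K \<union> ?P")
    unfolding S_def image_Un image_image image_insert image_empty fst_conv snd_conv by (rule refl)
  finally have E: "uedges ?H = ?K \<union> ?P" .
  have "card (?K \<union> ?P) = card ?K + card ?P"
    by (rule card_Un_disjoint) (auto simp: doubleton_eq_iff)
  also have "card ?K = 5" by (simp add: doubleton_eq_iff)
  also have "card ?P = n - 4" by (simp add: card_image inj_on_def doubleton_eq_iff)
  finally have card_E: "card (uedges ?H) = card (pverts (G1 x n)) + 1" using card_V n E by simp
  have mk: "mk_symmetric ?H = G1 x n"
    using sym by (cases "G1 x n") (auto simp: mk_symmetric_def sym_def)
  have r1: "u \<rightarrow>\<^sup>*\<^bsub>?H\<^esub> Inl x" if "u \<in> pverts (G1 x n)" for u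
  proof (cases "u = Inl x")
    case False
    with that x have "(u, Inl x) \<in> parcs (G1 x n)" unfolding V A by auto
    then show ?thesis by (intro H.reachable_adjI) simp
  qed (use that in auto)
  have r2: "Inl x \<rightarrow>\<^sup>*\<^bsub>?H\<^esub> u" if "u \<in> pverts (G1 x n)" for u
  proof (rule symmetric_reachable[OF _ r1[OF that]])
    show "symmetric ?H" using sym by (simp add: symmetric_def)
  qed
  have "verts ?H \<noteq> {}" unfolding with_proj_simps V by simp
  moreover have "u \<rightarrow>\<^sup>*\<^bsub>?H\<^esub> v" if "u \<in> verts ?H" "v \<in> verts ?H" for u v
    using H.reachable_trans[OF r1 r2] that by simp
  ultimately have "strongly_connected ?H" unfolding strongly_connected_def by blast
  then have "connected ?H" by (simp add: connected_def mk)
  then show "bicyclic ?H" using graph card_E by (simp add: bicyclic_def)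
qed

end

theory Submission
  imports Defs "Jordan_Normal_Form.Schur_Decomposition"
begin

text \<open>
  The Kelmans transformation at vertices \<open>u\<close>, \<open>v\<close> moves the private neighbours of \<open>v\<close> over to \<open>u\<close>.
  It preserves the number of edges, and connectedness if \<open>u\<close> and \<open>v\<close> have distance at most \<open>2\<close>.
  Replace the basis vectors of \<open>u\<close> and \<open>v\<close> by their sum and difference. In this basis, the
  transformation turns the adjacency matrix plus the identity into its entrywise absolute value,
  because the only signs come from the private neighbours of \<open>v\<close>. The traces of all powers thus do not
  decrease, and the trace of the fourth power increases when both vertices have private neighbours;
  hence so does \<open>EE\<close>, which is \<open>1/e\<close> times the trace of the exponential of that matrix.
  A maximiser of \<open>EE\<close> therefore has nested neighbourhoods at distance at most \<open>2\<close>. A vertex of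
  maximal degree then dominates, and the two remaining edges must share an end vertex, which leaves
  only the graph \<open>G1\<close>.
\<close>

section \<open>Traces of powers and exponentials of eigenvalues\<close>

text \<open>Schur triangularisation asks for an explicit list of linear factors. Splitting off a
  root lowers the degree and the number of roots by one each, so the equality between the two
  survives the induction.\<close>

lemma linear_factorization_of_size_proots:
  fixes p :: "'a::field poly"
  assumes "size (proots p) = degree p" and "lead_coeff p = 1"
  shows "\<exists>es. p = (\<Prod>a\<leftarrow>es. [:- a, 1:])"
  using assms
proof (induction "degree p" arbitrary: p)
  case 0
  then have "p = 1" by (metis degree_eq_zeroE lead_coeff_pCons(2) one_pCons)
  then show ?case by (intro exI[of _ "[]"]) simp
next
  case (Suc d)
  have p0: "p \<noteq> 0" using Suc.prems by auto
  have "proots p \<noteq> {#}" using Suc by auto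
  then obtain r where "r \<in># proots p" by blast
  then have "poly p r = 0" using p0 by simp
  then obtain q where q: "p = [:-r, 1:] * q" by (metis poly_eq_0_iff_dvd dvdE)
  have q0: "q \<noteq> 0" using q p0 by auto
  have dq: "degree p = Suc (degree q)" unfolding q using q0 by (subst degree_mult_eq) auto
  have "size (proots p) = Suc (size (proots q))" unfolding q using q0 by (subst proots_mult) auto
  then have "size (proots q) = degree q" using Suc.prems(1) dq by simp
  moreover have "lead_coeff q = 1"
    using Suc.prems(2) unfolding q lead_coeff_mult by simp
  moreover have "d = degree q" using Suc.hyps(2) dq by simp
  ultimately obtain es where "q = (\<Prod>a\<leftarrow>es. [:- a, 1:])"
    using Suc.hyps(1) by blast
  then show ?case unfolding q by (intro exI[of _ "r # es"]) simp
qed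

lemma proots_prod_linear_factors:
  "proots (\<Prod>a\<leftarrow>es. [:- a, 1:]) = mset (es :: 'a::idom list)"
proof (induction es)
  case (Cons a es)
  have "(\<Prod>a\<leftarrow>es. [:- a, 1:]) \<noteq> 0" by (auto simp: prod_list_zero_iff)
  then have "proots ([:- a, 1:] * (\<Prod>a\<leftarrow>es. [:- a, 1:])) = {#a#} + mset es"
    using Cons by (subst proots_mult) auto
  then show ?case by simp
qed simp

section \<open>Trace, similarity and triangular matrices\<close>

definition mtrace :: "'a::comm_monoid_add mat \<Rightarrow> 'a" where
  "mtrace A = (\<Sum>i<dim_row A. A $$ (i, i))"

lemma mult_mat_index:
  assumes "A \<in> carrier_mat n n" "B \<in> carrier_mat n n" "i < n" "j < n"
  shows "(A * B) $$ (i, j) = (\<Sum>k<n. A $$ (i, k) * B $$ (k, j))"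
  using assms by (auto simp: scalar_prod_def atLeast0LessThan)

lemma mtrace_comm:
  fixes A B :: "'a::comm_semiring_0 mat"
  assumes A: "A \<in> carrier_mat n n" and B: "B \<in> carrier_mat n n"
  shows "mtrace (A * B) = mtrace (B * A)"
proof -
  have "mtrace (A * B) = (\<Sum>i<n. \<Sum>k<n. A $$ (i, k) * B $$ (k, i))"
    unfolding mtrace_def using A B mult_mat_index[OF A B] by auto
  also have "\<dots> = (\<Sum>k<n. \<Sum>i<n. B $$ (k, i) * A $$ (i, k))"
    by (subst sum.swap) (simp add: mult.commute)
  also have "\<dots> = mtrace (B * A)"
    unfolding mtrace_def using A B mult_mat_index[OF B A] by auto
  finally show ?thesis .
qed

lemma mtrace_similar:
  fixes A B :: "'a::comm_ring_1 mat"
  assumes "similar_mat A B"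
  shows "mtrace A = mtrace B"
proof -
  obtain n P Q where *: "{A, B, P, Q} \<subseteq> carrier_mat n n" "Q * P = 1\<^sub>m n" "A = P * B * Q"
    using similar_matD[OF assms] by blast
  have "mtrace A = mtrace (Q * (P * B))" using * by (subst mtrace_comm[of _ n]) auto
  also have "Q * (P * B) = (Q * P) * B" using * by (intro assoc_mult_mat[symmetric]) auto
  also have "\<dots> = B" using * left_mult_one_mat[of B n n] by simp
  finally show ?thesis .
qed

lemma similar_mat_add_one:
  fixes A B :: "'a::comm_ring_1 mat"
  assumes "similar_mat A B" and A: "A \<in> carrier_mat n n"
  shows "similar_mat (A + 1\<^sub>m n) (B + 1\<^sub>m n)"
proof -
  obtain P Q where *: "similar_mat_wit A B P Q" using assms unfolding similar_mat_def by blast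
  note w = similar_mat_witD2[OF A *]
  have "P * (B + 1\<^sub>m n) * Q = (P * B + P) * Q" using w by (simp add: mult_add_distrib_mat[of _ n n _ n])
  also have "\<dots> = A + 1\<^sub>m n" using w by (simp add: add_mult_distrib_mat[of _ n n _ _ n])
  finally show ?thesis using w by (intro similar_matI[of _ _ P Q n]) auto
qed

lemma similar_mat_pow:
  assumes "similar_mat A B"
  shows "similar_mat (A ^\<^sub>m k) (B ^\<^sub>m k)"
  using assms similar_mat_wit_pow unfolding similar_mat_def by blast

lemma upper_triangular_pow:
  fixes B :: "'a::comm_semiring_1 mat"
  assumes B: "B \<in> carrier_mat n n" "upper_triangular B"
  shows "upper_triangular (B ^\<^sub>m k) \<and> (\<forall>i<n. (B ^\<^sub>m k) $$ (i, i) = B $$ (i, i) ^ k)"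
proof (induction k)
  case 0
  then show ?case using B by auto
next
  case (Suc k)
  have c: "B ^\<^sub>m k \<in> carrier_mat n n" using B by simp
  have entry: "(B ^\<^sub>m Suc k) $$ (i, j) = (\<Sum>l<n. (B ^\<^sub>m k) $$ (i, l) * B $$ (l, j))"
    if "i < n" "j < n" for i j
    using mult_mat_index[OF c B(1) that] by simp
  have lower: "(B ^\<^sub>m k) $$ (i, l) = 0" "B $$ (i, l) = 0" if "l < i" "i < n" for i l
    using Suc B c that unfolding upper_triangular_def by auto
  \<comment> \<open>A nonzero term needs \<open>i \<le> l\<close> and \<open>l \<le> j\<close>; on
    or below the diagonal this leaves only \<open>j = l = i\<close>.\<close>
  have "(B ^\<^sub>m k) $$ (i, l) * B $$ (l, j) = (if j = i \<and> l = i then B $$ (i, i) ^ Suc k else 0)"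
    if "i < n" "l < n" "j \<le> i" for i j l
  proof (cases "l < i \<or> j < l")
    case True
    then show ?thesis using lower that by auto
  next
    case False
    then have "l = i" "j = i" using that by auto
    then show ?thesis using Suc that by (simp add: mult.commute)
  qed
  then have "(B ^\<^sub>m Suc k) $$ (i, j) = (if j = i then B $$ (i, i) ^ Suc k else 0)" if "i < n" "j \<le> i" for i j
    using that entry[of i j] by (auto simp: sum.delta)
  then show ?case using c B unfolding upper_triangular_def by auto
qed

text \<open>
  The shift by the identity is needed for the Kelmans transformation at adjacent vertices \<open>u\<close>, \<open>v\<close>:
  in the basis used there, the adjacency matrix has the negative diagonal entry \<open>-1\<close> at \<open>v\<close>.
\<close>

lemma exp_eigenvalues_sums:
  fixes A :: "real mat"
  assumes A: "A \<in> carrier_mat n n" and real: "size (proots (char_poly A)) = n"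
  shows "(\<lambda>k. mtrace ((A + 1\<^sub>m n) ^\<^sub>m k) / fact k) sums (exp 1 * (\<Sum>x\<in>#proots (char_poly A). exp x))"
proof -
  \<comment> \<open>All eigenvalues are real, so the characteristic polynomial splits and a
    triangular form exists over the reals. Its diagonal lists the eigenvalues with
    multiplicity.\<close>
  have "\<exists>es. char_poly A = (\<Prod>a\<leftarrow>es. [:- a, 1:])"
    using degree_monic_char_poly[OF A] real by (intro linear_factorization_of_size_proots) auto
  then obtain B where B: "B \<in> carrier_mat n n" "upper_triangular B" "similar_mat A B"
    using schur_decomposition_exists[OF A] by blast
  have "proots (char_poly A) = mset (diag_mat B)"
    using char_poly_similar[OF B(3)] char_poly_upper_triangular[OF B(1,2)]
    by (simp add: proots_prod_linear_factors)
  then have "(\<Sum>x\<in>#proots (char_poly A). exp x) = sum_list (map exp (diag_mat B))"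
    by (metis mset_map sum_mset_sum_list)
  also have "\<dots> = (\<Sum>i<n. exp (B $$ (i, i)))"
    using B(1) by (simp add: diag_mat_def sum_list_sum_nth atLeast0LessThan)
  \<comment> \<open>The factor \<open>exp 1\<close> accounts for the shift of every eigenvalue by
    one.\<close>
  finally have sum: "exp 1 * (\<Sum>x\<in>#proots (char_poly A). exp x) = (\<Sum>i<n. exp (B $$ (i, i) + 1))"
    by (simp add: sum_distrib_left exp_add mult.commute)
  let ?C = "B + 1\<^sub>m n"
  have C: "?C \<in> carrier_mat n n" "upper_triangular ?C" using B by (auto simp: upper_triangular_def)
  have "mtrace ((A + 1\<^sub>m n) ^\<^sub>m k) = (\<Sum>i<n. (B $$ (i, i) + 1) ^ k)" for k
  proof -
    have "mtrace ((A + 1\<^sub>m n) ^\<^sub>m k) = mtrace (?C ^\<^sub>m k)"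
      by (intro mtrace_similar similar_mat_pow similar_mat_add_one B A)
    also have "\<dots> = (\<Sum>i<n. ?C $$ (i, i) ^ k)"
      unfolding mtrace_def using upper_triangular_pow[OF C] B by simp
    finally show ?thesis using B by simp
  qed
  moreover have "(\<lambda>k. \<Sum>i<n. (B $$ (i, i) + 1) ^ k / fact k) sums (\<Sum>i<n. exp (B $$ (i, i) + 1))"
  proof (rule sums_sum)
    fix i
    show "(\<lambda>k. (B $$ (i, i) + 1) ^ k / fact k) sums exp (B $$ (i, i) + 1)"
      using exp_converges[of "B $$ (i, i) + 1"] by (simp add: divide_inverse mult.commute)
  qed
  ultimately show ?thesis unfolding sum by (simp add: sum_divide_distrib)
qed

section \<open>Entrywise domination of matrix powers\<close>

lemma abs_pow_mat_le:
  fixes X Y :: "real mat"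
  assumes X: "X \<in> carrier_mat n n" and Y: "Y \<in> carrier_mat n n"
    and le: "\<And>i j. i < n \<Longrightarrow> j < n \<Longrightarrow> \<bar>X $$ (i, j)\<bar> \<le> Y $$ (i, j)"
    and "i < n" "j < n"
  shows "\<bar>(X ^\<^sub>m k) $$ (i, j)\<bar> \<le> (Y ^\<^sub>m k) $$ (i, j)"
  using assms(4,5)
proof (induction k arbitrary: i j)
  case 0
  then show ?case using X Y by simp
next
  case (Suc k)
  have "(X ^\<^sub>m Suc k) $$ (i, j) = (\<Sum>l<n. (X ^\<^sub>m k) $$ (i, l) * X $$ (l, j))"
    using mult_mat_index[of "X ^\<^sub>m k" n X] X Suc by simp
  moreover have "(Y ^\<^sub>m Suc k) $$ (i, j) = (\<Sum>l<n. (Y ^\<^sub>m k) $$ (i, l) * Y $$ (l, j))"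
    using mult_mat_index[of "Y ^\<^sub>m k" n Y] Y Suc by simp
  \<comment> \<open>The induction hypothesis also makes the entries of \<open>Y ^\<^sub>m k\<close>
    nonnegative, as they bound absolute values; hence the two bounds may be multiplied.\<close>
  moreover have *: "\<bar>(X ^\<^sub>m k) $$ (i, l) * X $$ (l, j)\<bar> \<le> (Y ^\<^sub>m k) $$ (i, l) * Y $$ (l, j)" if "l < n" for l
    unfolding abs_mult
    by (rule mult_mono[OF Suc.IH[OF Suc.prems(1) that] le[OF that Suc.prems(2)]
          order_trans[OF abs_ge_zero Suc.IH[OF Suc.prems(1) that]] abs_ge_zero])
  have "\<bar>\<Sum>l<n. (X ^\<^sub>m k) $$ (i, l) * X $$ (l, j)\<bar> \<le> (\<Sum>l<n. (Y ^\<^sub>m k) $$ (i, l) * Y $$ (l, j))"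
    using * by (intro order_trans[OF sum_abs] sum_mono) simp
  ultimately show ?case by simp
qed

lemma mtrace_pow_mono:
  fixes X Y :: "real mat"
  assumes X: "X \<in> carrier_mat n n" and Y: "Y \<in> carrier_mat n n"
    and le: "\<And>i j. i < n \<Longrightarrow> j < n \<Longrightarrow> \<bar>X $$ (i, j)\<bar> \<le> Y $$ (i, j)"
  shows "mtrace (X ^\<^sub>m k) \<le> mtrace (Y ^\<^sub>m k)"
proof -
  have "(X ^\<^sub>m k) $$ (i, i) \<le> (Y ^\<^sub>m k) $$ (i, i)" if "i < n" for i
    using abs_pow_mat_le[OF X Y le that that, of k] by simp
  then show ?thesis unfolding mtrace_def using X Y by (auto intro: sum_mono)
qed

text \<open>The trace of a square is the sum of the products of opposite entries. Each product is
  dominated, so one strict pair suffices. The matrices need not be symmetric, which is why the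
  opposite entry needs its own positivity assumption to keep the inequality strict.\<close>

lemma mtrace_pow_double_strict_mono:
  fixes X Y :: "real mat"
  assumes X: "X \<in> carrier_mat n n" and Y: "Y \<in> carrier_mat n n"
    and le: "\<And>i j. i < n \<Longrightarrow> j < n \<Longrightarrow> \<bar>X $$ (i, j)\<bar> \<le> Y $$ (i, j)"
    and ij: "i < n" "j < n"
    and less: "\<bar>(X ^\<^sub>m k) $$ (i, j)\<bar> < (Y ^\<^sub>m k) $$ (i, j)" and pos: "0 < (Y ^\<^sub>m k) $$ (j, i)"
  shows "mtrace (X ^\<^sub>m k * X ^\<^sub>m k) < mtrace (Y ^\<^sub>m k * Y ^\<^sub>m k)"
proof -
  define x where "x = (\<lambda>i j. (X ^\<^sub>m k) $$ (i, j))"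
  define y where "y = (\<lambda>i j. (Y ^\<^sub>m k) $$ (i, j))"
  have xy: "\<bar>x a b\<bar> \<le> y a b" if "a < n" "b < n" for a b
    unfolding x_def y_def using abs_pow_mat_le[OF X Y le that] by simp
  have *: "x a b * x b a \<le> y a b * y b a" if "a < n" "b < n" for a b
  proof -
    have "x a b * x b a \<le> \<bar>x a b\<bar> * \<bar>x b a\<bar>" by (metis abs_ge_self abs_mult)
    also have "\<dots> \<le> y a b * y b a"
      using that by (intro mult_mono xy order_trans[OF abs_ge_zero xy] abs_ge_zero)
    finally show ?thesis .
  qed
  have "x i j * x j i \<le> \<bar>x i j\<bar> * \<bar>x j i\<bar>" by (metis abs_ge_self abs_mult)
  also have "\<dots> \<le> \<bar>x i j\<bar> * y j i" using xy ij by (intro mult_left_mono) auto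
  also have "\<dots> < y i j * y j i" using less pos unfolding x_def y_def by (intro mult_strict_right_mono) auto
  finally have **: "x i j * x j i < y i j * y j i" .
  have "(\<Sum>a<n. \<Sum>b<n. x a b * x b a) < (\<Sum>a<n. \<Sum>b<n. y a b * y b a)"
  proof (rule sum_strict_mono_ex1)
    show "\<forall>a\<in>{..<n}. (\<Sum>b<n. x a b * x b a) \<le> (\<Sum>b<n. y a b * y b a)" using * by (auto intro: sum_mono)
    show "\<exists>a\<in>{..<n}. (\<Sum>b<n. x a b * x b a) < (\<Sum>b<n. y a b * y b a)"
      using ij * ** by (intro bexI[of _ i] sum_strict_mono_ex1 bexI[of _ j]) auto
  qed simp
  moreover have "mtrace (Z ^\<^sub>m k * Z ^\<^sub>m k) = (\<Sum>a<n. \<Sum>b<n. (Z ^\<^sub>m k) $$ (a, b) * (Z ^\<^sub>m k) $$ (b, a))"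
    if "Z \<in> carrier_mat n n" for Z :: "real mat"
    unfolding mtrace_def using that mult_mat_index[of "Z ^\<^sub>m k" n "Z ^\<^sub>m k"] by auto
  ultimately show ?thesis using X Y unfolding x_def y_def by auto
qed

section \<open>Graphs with nested neighbourhoods\<close>

text \<open>This is \<open>G1\<close> over an arbitrary vertex set: two triangles on the common edge
  \<open>z a\<close>, with third vertices \<open>b\<close> and \<open>c\<close>, and all further
  vertices pendant at \<open>z\<close>.\<close>

definition book :: "'a set \<Rightarrow> 'a rel \<Rightarrow> bool" where
  "book V E \<longleftrightarrow> (\<exists>z a b c. distinct [z, a, b, c] \<and> {z, a, b, c} \<subseteq> V \<and>
     E = {(u, v). u \<in> V \<and> v \<in> V \<and> u \<noteq> v \<and> (u = z \<or> v = z \<or> {u, v} = {a, b} \<or> {u, v} = {a, c})})"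

text \<open>Adjacency depends only on the roles of the four distinguished vertices. Matching these
  and choosing any bijection between the remaining vertices therefore gives an isomorphism.\<close>

lemma book_iso:
  assumes "book V E" "book V' E'" and fin: "finite V" "finite V'" and card: "card V = card V'"
  shows "\<exists>f. bij_betw f V V' \<and> (\<forall>u\<in>V. \<forall>v\<in>V. (u, v) \<in> E \<longleftrightarrow> (f u, f v) \<in> E')"
proof -
  obtain z a b c where s: "distinct [z, a, b, c]" "{z, a, b, c} \<subseteq> V"
    and E: "E = {(u, v). u \<in> V \<and> v \<in> V \<and> u \<noteq> v \<and> (u = z \<or> v = z \<or> {u, v} = {a, b} \<or> {u, v} = {a, c})}"
    using assms(1) unfolding book_def by blast
  obtain z' a' b' c' where s': "distinct [z', a', b', c']" "{z', a', b', c'} \<subseteq> V'"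
    and E': "E' = {(u, v). u \<in> V' \<and> v \<in> V' \<and> u \<noteq> v \<and>
      (u = z' \<or> v = z' \<or> {u, v} = {a', b'} \<or> {u, v} = {a', c'})}"
    using assms(2) unfolding book_def by blast
  have "card (V - {z, a, b, c}) = card (V' - {z', a', b', c'})"
    using s s' card by (simp add: card_Diff_subset)
  then obtain g where g: "bij_betw g (V - {z, a, b, c}) (V' - {z', a', b', c'})"
    using fin finite_same_card_bij[of "V - {z, a, b, c}"] by blast
  define h where "h = (\<lambda>x. if x = z then z' else if x = a then a' else if x = b then b' else c')"
  define f where "f = (\<lambda>x. if x \<in> {z, a, b, c} then h x else g x)"
  have h: "bij_betw h {z, a, b, c} {z', a', b', c'}"
    using s(1) s'(1) unfolding h_def bij_betw_def inj_on_def by auto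
  have "bij_betw f ({z, a, b, c} \<union> (V - {z, a, b, c})) ({z', a', b', c'} \<union> (V' - {z', a', b', c'}))"
  proof (rule bij_betw_combine)
    show "bij_betw f {z, a, b, c} {z', a', b', c'}"
      using h by (rule bij_betw_cong[THEN iffD1, rotated]) (simp add: f_def)
    show "bij_betw f (V - {z, a, b, c}) (V' - {z', a', b', c'})"
      using g by (rule bij_betw_cong[THEN iffD1, rotated]) (simp add: f_def)
  qed blast
  moreover have "{z, a, b, c} \<union> (V - {z, a, b, c}) = V" "{z', a', b', c'} \<union> (V' - {z', a', b', c'}) = V'"
    using s(2) s'(2) by blast+
  ultimately have f: "bij_betw f V V'" by simp
  have inj: "f u = f v \<longleftrightarrow> u = v" if "u \<in> V" "v \<in> V" for u v
    using f that unfolding bij_betw_def by (auto dest: inj_onD)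
  have fz: "f z = z'" "f a = a'" "f b = b'" "f c = c'" using s(1) unfolding f_def h_def by auto
  have mem: "f u \<in> V'" if "u \<in> V" for u using f that bij_betwE by blast
  have "(u, v) \<in> E \<longleftrightarrow> (f u, f v) \<in> E'" if "u \<in> V" "v \<in> V" for u v
    unfolding E E' using that mem inj[OF that(1)] inj[OF that(2)] s(2)
    by (auto simp: doubleton_eq_iff fz[symmetric])
  with f show ?thesis by blast
qed

text \<open>This moves the structure between the vertices of a graph and their positions in an
  enumeration, in both directions.\<close>

lemma book_pullback:
  assumes "book V E" and f: "bij_betw f V' V"
  shows "book V' {(i, j). i \<in> V' \<and> j \<in> V' \<and> (f i, f j) \<in> E}"
proof -
  obtain z a b c where s: "distinct [z, a, b, c]" "{z, a, b, c} \<subseteq> V"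
    and E: "E = {(u, v). u \<in> V \<and> v \<in> V \<and> u \<noteq> v \<and> (u = z \<or> v = z \<or> {u, v} = {a, b} \<or> {u, v} = {a, c})}"
    using assms(1) unfolding book_def by blast
  have "V = f ` V'" using f by (simp add: bij_betw_def)
  then obtain z' a' b' c' where s': "{z', a', b', c'} \<subseteq> V'"
    and eq: "z = f z'" "a = f a'" "b = f b'" "c = f c'"
    using s(2) by auto
  have inj: "f u = f v \<longleftrightarrow> u = v" if "u \<in> V'" "v \<in> V'" for u v
    using f that unfolding bij_betw_def by (auto dest: inj_onD)
  have mem: "f u \<in> V" if "u \<in> V'" for u using f that bij_betwE by blast
  have "distinct [z', a', b', c']" using s(1) eq by auto
  moreover have "(i, j) \<in> {(i, j). i \<in> V' \<and> j \<in> V' \<and> (f i, f j) \<in> E} \<longleftrightarrow> (i, j) \<in> {(u, v). u \<in> V' \<and> v \<in> V' \<and> u \<noteq> v \<and>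
      (u = z' \<or> v = z' \<or> {u, v} = {a', b'} \<or> {u, v} = {a', c'})}" for i j
    using s' mem inj[of i] inj[of j] unfolding E eq by (auto simp: doubleton_eq_iff)
  ultimately show ?thesis unfolding book_def using s' by (metis (no_types, lifting) pred_equals_eq2 subrelI subset_antisym)
qed

section \<open>Nested neighbourhoods force a book\<close>

text \<open>The vertex \<open>u\<close> is excluded so that an edge between \<open>u\<close> and
  \<open>v\<close> does not count as private.\<close>

definition private_nbrs :: "'a rel \<Rightarrow> 'a \<Rightarrow> 'a \<Rightarrow> 'a set" where
  "private_nbrs E v u = {w. (v, w) \<in> E \<and> (u, w) \<notin> E \<and> w \<noteq> u}"

definition near :: "'a rel \<Rightarrow> 'a \<Rightarrow> 'a \<Rightarrow> bool" where
  "near E u v \<longleftrightarrow> (u, v) \<in> E \<or> (\<exists>y. (u, y) \<in> E \<and> (v, y) \<in> E)"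

text \<open>Take \<open>z\<close> of maximal degree. If \<open>w\<close> were at distance two from
  \<open>z\<close> through \<open>y\<close>, then \<open>w\<close> would be private to
  \<open>y\<close> against \<open>z\<close>, so by nestedness \<open>z\<close> would have no private
  neighbour against \<open>y\<close>, and \<open>y\<close> would have larger degree than
  \<open>z\<close>. Hence nothing lies beyond distance one from \<open>z\<close>.\<close>

lemma dominating_vertex_of_nested:
  assumes E: "E \<subseteq> V \<times> V" "sym E" "irrefl E" and V: "finite V" "V \<noteq> {}"
    and conn: "\<And>u v. u \<in> V \<Longrightarrow> v \<in> V \<Longrightarrow> (u, v) \<in> E\<^sup>*"
    and nested: "\<And>u v. u \<noteq> v \<Longrightarrow> near E u v \<Longrightarrow> private_nbrs E u v = {} \<or> private_nbrs E v u = {}"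
  obtains z where "z \<in> V" "\<And>w. w \<in> V \<Longrightarrow> w \<noteq> z \<Longrightarrow> (z, w) \<in> E"
proof -
  define N where "N = (\<lambda>x. E `` {x})"
  have fin: "finite (N x)" for x
    unfolding N_def using E(1) V(1) by (meson finite_SigmaI finite_Image finite_subset)
  obtain z where z: "z \<in> V" "\<And>y. y \<in> V \<Longrightarrow> card (N y) \<le> card (N z)"
  proof -
    have "Max (card ` N ` V) \<in> card ` N ` V" using V by (intro Max_in) auto
    then obtain z where "z \<in> V" "card (N z) = Max (card ` N ` V)" by auto
    then show thesis using V by (intro that[of z]) auto
  qed
  have irr: "(x, x) \<notin> E" for x using E(3) by (rule irreflD)
  have dist2: "w = z \<or> (z, w) \<in> E" if y: "(z, y) \<in> E" "(y, w) \<in> E" for y w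
  proof (rule ccontr)
    assume w: "\<not> (w = z \<or> (z, w) \<in> E)"
    have "y \<noteq> z" using y irr by blast
    moreover have "near E y z" using y symD[OF E(2)] unfolding near_def by blast
    moreover have "w \<in> private_nbrs E y z" using y w unfolding private_nbrs_def by blast
    ultimately have "private_nbrs E z y = {}" using nested by blast
    then have "N z - {y} \<subseteq> N y" unfolding N_def private_nbrs_def by blast
    \<comment> \<open>Compared with \<open>N z\<close>, the vertex \<open>y\<close> is lost while
      \<open>z\<close> and \<open>w\<close> are gained, so \<open>y\<close> has at least one
      neighbour more than \<open>z\<close>.\<close>
    then have "insert z (insert w (N z - {y})) \<subseteq> N y"
      using y symD[OF E(2)] unfolding N_def by blast
    then have "card (insert z (insert w (N z - {y}))) \<le> card (N y)" by (rule card_mono[OF fin])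
    moreover have "y \<in> N z" "z \<notin> N z" "w \<notin> N z" "w \<noteq> z" using y w irr unfolding N_def by auto
    then have "card (insert z (insert w (N z - {y}))) = card (N z) + 1"
      using fin card_Suc_Diff1[OF fin, of y z] by auto
    moreover have "y \<in> V" using y E(1) by blast
    ultimately show False using z(2)[of y] by simp
  qed
  have "w = z \<or> (z, w) \<in> E" if "w \<in> V" for w
    using conn[OF z(1) that]
  proof (induction rule: rtrancl_induct)
    case (step x y)
    then show ?case using dist2 by blast
  qed simp
  then show thesis using that z(1) by blast
qed

text \<open>A dominating vertex accounts for all but two edges. If these two were disjoint, one end
  of each would have a private neighbour against the other, although both are adjacent to the
  dominating vertex. So they share an end.\<close>

lemma book_of_nested:
  assumes E: "E \<subseteq> V \<times> V" "sym E" "irrefl E" and V: "finite V" and card: "card E = 2 * (card V + 1)"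
    and conn: "\<And>u v. u \<in> V \<Longrightarrow> v \<in> V \<Longrightarrow> (u, v) \<in> E\<^sup>*"
    and nested: "\<And>u v. u \<noteq> v \<Longrightarrow> near E u v \<Longrightarrow> private_nbrs E u v = {} \<or> private_nbrs E v u = {}"
  shows "book V E"
proof -
  have "V \<noteq> {}" using card E(1) by auto
  then obtain z where z: "z \<in> V" "\<And>w. w \<in> V \<Longrightarrow> w \<noteq> z \<Longrightarrow> (z, w) \<in> E"
    using dominating_vertex_of_nested[OF E V _ conn nested] by blast
  have irr: "(x, x) \<notin> E" for x using E(3) by (rule irreflD)
  have sym: "(y, x) \<in> E" if "(x, y) \<in> E" for x y using symD[OF E(2) that] .
  define R where "R = {(u, v) \<in> E. u \<noteq> z \<and> v \<noteq> z}"
  have finE: "finite E" using E(1) V by (meson finite_SigmaI finite_subset)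
  have finR: "finite R" by (rule finite_subset[OF _ finE]) (auto simp: R_def)
  have E_eq: "E = R \<union> ({z} \<times> (V - {z}) \<union> (V - {z}) \<times> {z})"
    using z E(1) irr sym[OF z(2)] unfolding R_def by auto
  have "card E = card R + card ({z} \<times> (V - {z}) \<union> (V - {z}) \<times> {z})"
    unfolding E_eq using finR V by (intro card_Un_disjoint) (auto simp: R_def)
  also have "card ({z} \<times> (V - {z}) \<union> (V - {z}) \<times> {z}) = (card V - 1) + (card V - 1)"
    using V z(1) by (subst card_Un_disjoint) (auto simp: card_cartesian_product)
  \<comment> \<open>Counting ordered pairs, \<open>2 * (card V + 1)\<close> minus
    \<open>2 * (card V - 1)\<close> leaves four, that is, two edges avoiding
    \<open>z\<close>.\<close>
  finally have cardR: "card R = 4"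
    using card V z(1) by (cases "card V") auto
  have R: "(x, x) \<notin> R" "(x, y) \<in> R \<Longrightarrow> (y, x) \<in> R" for x y using irr sym unfolding R_def by auto
  have "R \<noteq> {}" using cardR by auto
  then obtain a b where ab: "(a, b) \<in> R" by auto
  have ba: "a \<noteq> b" "(b, a) \<in> R" using ab R by blast+
  then have "card (R - {(a, b), (b, a)}) = 2"
    using ab cardR by (subst card_Diff_subset) auto
  then have "R - {(a, b), (b, a)} \<noteq> {}" by (metis card.empty zero_neq_numeral)
  then obtain c d where cd: "(c, d) \<in> R" "(c, d) \<noteq> (a, b)" "(c, d) \<noteq> (b, a)" by auto
  have R_eq: "{(a, b), (b, a), (c, d), (d, c)} = R"
  proof (rule card_subset_eq[OF finR])
    show "{(a, b), (b, a), (c, d), (d, c)} \<subseteq> R" using ab cd(1) R(2) by blast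
    have "a \<noteq> b" "c \<noteq> d" using ab cd(1) R(1) by blast+
    then have "card {(a, b), (b, a), (c, d), (d, c)} = 4" using cd by auto
    then show "card {(a, b), (b, a), (c, d), (d, c)} = card R" using cardR by simp
  qed
  have ne: "a \<noteq> b" "c \<noteq> d" "a \<noteq> z" "b \<noteq> z" "c \<noteq> z" "d \<noteq> z" "a \<in> V" "b \<in> V" "c \<in> V" "d \<in> V"
    using ab cd(1) irr E(1) unfolding R_def by blast+
  have share: "a = c \<or> a = d \<or> b = c \<or> b = d"
  proof (rule ccontr)
    assume *: "\<not> (a = c \<or> a = d \<or> b = c \<or> b = d)"
    \<comment> \<open>The dominating vertex \<open>z\<close> is a common neighbour.\<close>
    have "near E a c" using z ne sym unfolding near_def by blast
    moreover have "(a, d) \<notin> R" "(c, b) \<notin> R" unfolding R_eq[symmetric] using * ne by auto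
    then have "b \<in> private_nbrs E a c" "d \<in> private_nbrs E c a"
      using ab cd * ne unfolding R_def private_nbrs_def by auto
    ultimately show False using nested[of a c] * by blast
  qed
  have book: "book V E" if s: "distinct [z, a', b', c']" "{z, a', b', c'} \<subseteq> V"
    and R': "R = {(a', b'), (b', a'), (a', c'), (c', a')}" for a' b' c'
    unfolding book_def
  proof (intro exI conjI)
    show "E = {(u, v). u \<in> V \<and> v \<in> V \<and> u \<noteq> v \<and> (u = z \<or> v = z \<or> {u, v} = {a', b'} \<or> {u, v} = {a', c'})}"
      unfolding E_eq R' using s z(1) by (auto simp: doubleton_eq_iff)
  qed (use s in auto)
  \<comment> \<open>The shared end takes the role of \<open>a\<close> in \<open>book\<close>, the
    other two ends those of \<open>b\<close> and \<open>c\<close>.\<close>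
  from share show ?thesis
  proof (elim disjE)
    assume "a = c"
    then show ?thesis using ne cd z(1) by (intro book[of a b d]) (auto simp: R_eq[symmetric])
  next
    assume "a = d"
    then show ?thesis using ne cd z(1) by (intro book[of a b c]) (auto simp: R_eq[symmetric])
  next
    assume "b = c"
    then show ?thesis using ne cd z(1) by (intro book[of b a d]) (auto simp: R_eq[symmetric])
  next
    assume "b = d"
    then show ?thesis using ne cd z(1) by (intro book[of b a c]) (auto simp: R_eq[symmetric])
  qed
qed

text \<open>Every unordered edge is the image of exactly its two orientations, which differ because
  there are no loops.\<close>

lemma card_sym_irrefl_eq_double:
  assumes "finite E" "sym E" "irrefl E"
  shows "card E = 2 * card ((\<lambda>(u, v). {u, v}) ` E)"
proof -
  let ?f = "\<lambda>(u, v). {u, v}"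
  have "card E = card (\<Union>e \<in> ?f ` E. {p \<in> E. ?f p = e})" by (rule arg_cong[of _ _ card]) blast
  also have "\<dots> = (\<Sum>e \<in> ?f ` E. card {p \<in> E. ?f p = e})"
    using assms(1) by (intro card_UN_disjoint) auto
  also have "\<dots> = (\<Sum>e \<in> ?f ` E. 2)"
  proof (rule sum.cong[OF refl])
    fix e assume "e \<in> ?f ` E"
    then obtain u v where uv: "(u, v) \<in> E" "e = {u, v}" by auto
    then have "u \<noteq> v" "(v, u) \<in> E" using irreflD[OF assms(3)] symD[OF assms(2)] by auto
    then have "{p \<in> E. ?f p = e} = {(u, v), (v, u)}" using uv by (auto simp: doubleton_eq_iff)
    then show "card {p \<in> E. ?f p = e} = 2" using \<open>u \<noteq> v\<close> by simp
  qed
  finally show ?thesis by simp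
qed

section \<open>Estrada index of a relation\<close>

definition adj :: "nat \<Rightarrow> nat rel \<Rightarrow> real mat" where
  "adj n E = mat n n (\<lambda>(i, j). of_bool ((i, j) \<in> E))"

definition EE :: "nat \<Rightarrow> nat rel \<Rightarrow> real" where
  "EE n E = (\<Sum>x\<in>#proots (char_poly (adj n E)). exp x)"

lemma adj_carrier [simp]: "adj n E \<in> carrier_mat n n"
  by (simp add: adj_def)

lemma adj_index [simp]: "i < n \<Longrightarrow> j < n \<Longrightarrow> adj n E $$ (i, j) = of_bool ((i, j) \<in> E)"
  by (simp add: adj_def)

text \<open>The traces are those of any similar matrix, so the basis may be chosen freely; symmetry
  of \<open>E\<close> supplies the real spectrum.\<close>

lemma EE_sums:
  assumes "sym E" and X: "X \<in> carrier_mat n n" "similar_mat X (adj n E)"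
  shows "(\<lambda>k. mtrace ((X + 1\<^sub>m n) ^\<^sub>m k) / fact k) sums (exp 1 * EE n E)"
proof -
  have "size (proots (char_poly (adj n E))) = n"
    using assms(1) by (intro size_proots_char_poly_symmetric) (auto dest: symD)
  then show ?thesis
    using exp_eigenvalues_sums[OF X(1)] char_poly_similar[OF X(2)] unfolding EE_def by simp
qed

text \<open>Domination makes every term of the difference of the two trace series nonnegative, and
  the power \<open>k\<close> makes one of them positive.\<close>

lemma EE_less:
  assumes E: "sym E" "X \<in> carrier_mat n n" "similar_mat X (adj n E)"
    and E': "sym E'" "Y \<in> carrier_mat n n" "similar_mat Y (adj n E')"
    and le: "\<And>i j. i < n \<Longrightarrow> j < n \<Longrightarrow> \<bar>(X + 1\<^sub>m n) $$ (i, j)\<bar> \<le> (Y + 1\<^sub>m n) $$ (i, j)"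
    and less: "mtrace ((X + 1\<^sub>m n) ^\<^sub>m k) < mtrace ((Y + 1\<^sub>m n) ^\<^sub>m k)"
  shows "EE n E < EE n E'"
proof -
  let ?x = "\<lambda>k. mtrace ((X + 1\<^sub>m n) ^\<^sub>m k) / fact k"
  let ?y = "\<lambda>k. mtrace ((Y + 1\<^sub>m n) ^\<^sub>m k) / fact k"
  have x: "?x sums (exp 1 * EE n E)" and y: "?y sums (exp 1 * EE n E')"
    using EE_sums[OF E] EE_sums[OF E'] .
  have "X + 1\<^sub>m n \<in> carrier_mat n n" "Y + 1\<^sub>m n \<in> carrier_mat n n" using E(2) E'(2) by auto
  note mono = mtrace_pow_mono[OF this le]
  have "(\<lambda>k. ?y k - ?x k) sums (exp 1 * EE n E' - exp 1 * EE n E)" using sums_diff[OF y x] .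
  moreover have "0 < (\<Sum>k. ?y k - ?x k)"
  proof (rule suminf_pos2)
    show "summable (\<lambda>k. ?y k - ?x k)" using sums_diff[OF y x] by (rule sums_summable)
    show "0 \<le> ?y k - ?x k" for k using mono by (simp add: divide_right_mono)
    show "0 < ?y k - ?x k" using less by (simp add: divide_strict_right_mono)
  qed
  ultimately have "exp 1 * EE n E < exp 1 * EE n E'" by (simp add: sums_iff)
  then show ?thesis by simp
qed

section \<open>The Kelmans transformation\<close>

text \<open>
  The basis vectors at \<open>u\<close> and \<open>v\<close> are replaced by their sum and their difference. They are not
  normalised, so the conjugated adjacency matrix is not symmetric, but its entries are rational.
\<close>

definition swap_basis :: "nat \<Rightarrow> nat \<Rightarrow> nat \<Rightarrow> real mat" where
  "swap_basis n u v = mat n n (\<lambda>(k, j).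
     if j = u then of_bool (k = u) + of_bool (k = v)
     else if j = v then of_bool (k = u) - of_bool (k = v) else of_bool (k = j))"

definition swap_basis_inv :: "nat \<Rightarrow> nat \<Rightarrow> nat \<Rightarrow> real mat" where
  "swap_basis_inv n u v = mat n n (\<lambda>(i, k).
     if i = u then (of_bool (k = u) + of_bool (k = v)) / 2
     else if i = v then (of_bool (k = u) - of_bool (k = v)) / 2 else of_bool (k = i))"

lemma sum_delta_of_bool:
  fixes f :: "nat \<Rightarrow> real"
  assumes "u < n"
  shows "(\<Sum>k<n. f k * of_bool (k = u)) = f u" "(\<Sum>k<n. of_bool (k = u) * f k) = f u"
  using assms by (simp_all add: of_bool_def if_distrib[of "\<lambda>x. x * _"] if_distrib[of "\<lambda>x. _ * x"] cong: if_cong)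

lemma mult_swap_basis_index:
  assumes "A \<in> carrier_mat n n" "u < n" "v < n" "u \<noteq> v" "i < n" "j < n"
  shows "(A * swap_basis n u v) $$ (i, j) =
    (if j = u then A $$ (i, u) + A $$ (i, v) else if j = v then A $$ (i, u) - A $$ (i, v) else A $$ (i, j))"
proof -
  have c: "swap_basis n u v \<in> carrier_mat n n" by (simp add: swap_basis_def)
  show ?thesis using assms unfolding mult_mat_index[OF assms(1) c assms(5,6)]
    by (cases "j = u"; cases "j = v") (simp_all add: swap_basis_def distrib_left right_diff_distrib
        sum.distrib sum_subtractf sum_delta_of_bool)
qed

lemma swap_basis_inv_mult_index:
  assumes "A \<in> carrier_mat n n" "u < n" "v < n" "i < n" "j < n"
  shows "(swap_basis_inv n u v * A) $$ (i, j) =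
    (if i = u then (A $$ (u, j) + A $$ (v, j)) / 2 else if i = v then (A $$ (u, j) - A $$ (v, j)) / 2
     else A $$ (i, j))"
proof -
  have c: "swap_basis_inv n u v \<in> carrier_mat n n" by (simp add: swap_basis_inv_def)
  show ?thesis using assms unfolding mult_mat_index[OF c assms(1,4,5)]
    by (cases "i = u"; cases "i = v") (simp_all add: swap_basis_inv_def distrib_right left_diff_distrib
        add_divide_distrib diff_divide_distrib sum.distrib sum_subtractf sum_delta_of_bool
        sum_divide_distrib[symmetric])
qed

definition swap_conj :: "nat \<Rightarrow> nat \<Rightarrow> nat \<Rightarrow> real mat \<Rightarrow> real mat" where
  "swap_conj n u v A = swap_basis_inv n u v * A * swap_basis n u v"

lemma swap_conj_carrier [simp]: "swap_conj n u v A \<in> carrier_mat n n"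
  unfolding carrier_mat_def by (simp add: swap_conj_def swap_basis_def swap_basis_inv_def)

lemma similar_swap_conj:
  assumes A: "A \<in> carrier_mat n n" and uv: "u < n" "v < n" "u \<noteq> v"
  shows "similar_mat (swap_conj n u v A) A"
proof -
  have c: "swap_basis n u v \<in> carrier_mat n n" "swap_basis_inv n u v \<in> carrier_mat n n"
    by (simp_all add: swap_basis_def swap_basis_inv_def)
  have "swap_basis_inv n u v * swap_basis n u v = 1\<^sub>m n"
    using uv c by (intro eq_matI)
      (auto simp: swap_basis_inv_mult_index[OF c(1)] simp del: index_mult_mat(1), auto simp: swap_basis_def)
  moreover from this have "swap_basis n u v * swap_basis_inv n u v = 1\<^sub>m n"
    using mat_mult_left_right_inverse[OF c(2,1)] by simp
  ultimately show ?thesis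
    using c A by (intro similar_matI[of _ _ "swap_basis_inv n u v" "swap_basis n u v" n])
      (auto simp: swap_conj_def)
qed

lemma swap_conj_index:
  assumes A: "A \<in> carrier_mat n n" and uv: "u < n" "v < n" "u \<noteq> v"
  shows "swap_conj n u v A $$ (u, u) = (A $$ (u, u) + A $$ (u, v) + A $$ (v, u) + A $$ (v, v)) / 2"
    and "swap_conj n u v A $$ (v, v) = (A $$ (u, u) - A $$ (u, v) - A $$ (v, u) + A $$ (v, v)) / 2"
    and "swap_conj n u v A $$ (u, v) = (A $$ (u, u) - A $$ (u, v) + A $$ (v, u) - A $$ (v, v)) / 2"
    and "swap_conj n u v A $$ (v, u) = (A $$ (u, u) + A $$ (u, v) - A $$ (v, u) - A $$ (v, v)) / 2"
    and "\<And>w. w < n \<Longrightarrow> w \<noteq> u \<Longrightarrow> w \<noteq> v \<Longrightarrow> swap_conj n u v A $$ (u, w) = (A $$ (u, w) + A $$ (v, w)) / 2"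
    and "\<And>w. w < n \<Longrightarrow> w \<noteq> u \<Longrightarrow> w \<noteq> v \<Longrightarrow> swap_conj n u v A $$ (v, w) = (A $$ (u, w) - A $$ (v, w)) / 2"
    and "\<And>w. w < n \<Longrightarrow> w \<noteq> u \<Longrightarrow> w \<noteq> v \<Longrightarrow> swap_conj n u v A $$ (w, u) = A $$ (w, u) + A $$ (w, v)"
    and "\<And>w. w < n \<Longrightarrow> w \<noteq> u \<Longrightarrow> w \<noteq> v \<Longrightarrow> swap_conj n u v A $$ (w, v) = A $$ (w, u) - A $$ (w, v)"
    and "\<And>w x. w < n \<Longrightarrow> w \<noteq> u \<Longrightarrow> w \<noteq> v \<Longrightarrow> x < n \<Longrightarrow> x \<noteq> u \<Longrightarrow> x \<noteq> v \<Longrightarrow>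
      swap_conj n u v A $$ (w, x) = A $$ (w, x)"
proof -
  have c: "swap_basis_inv n u v * A \<in> carrier_mat n n" 
    using A by (intro mult_carrier_mat[of _ n n]) (simp_all add: swap_basis_inv_def)
  note i = mult_swap_basis_index[OF c uv] swap_basis_inv_mult_index[OF A uv(1,2)]
  show "swap_conj n u v A $$ (u, u) = (A $$ (u, u) + A $$ (u, v) + A $$ (v, u) + A $$ (v, v)) / 2"
    "swap_conj n u v A $$ (v, v) = (A $$ (u, u) - A $$ (u, v) - A $$ (v, u) + A $$ (v, v)) / 2"
    "swap_conj n u v A $$ (u, v) = (A $$ (u, u) - A $$ (u, v) + A $$ (v, u) - A $$ (v, v)) / 2"
    "swap_conj n u v A $$ (v, u) = (A $$ (u, u) + A $$ (u, v) - A $$ (v, u) - A $$ (v, v)) / 2"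
    unfolding swap_conj_def using uv by (simp_all add: i field_simps del: index_mult_mat(1))
  fix w assume w: "w < n" "w \<noteq> u" "w \<noteq> v"
  then show "swap_conj n u v A $$ (u, w) = (A $$ (u, w) + A $$ (v, w)) / 2"
    "swap_conj n u v A $$ (v, w) = (A $$ (u, w) - A $$ (v, w)) / 2"
    "swap_conj n u v A $$ (w, u) = A $$ (w, u) + A $$ (w, v)"
    "swap_conj n u v A $$ (w, v) = A $$ (w, u) - A $$ (w, v)"
    unfolding swap_conj_def using uv by (simp_all add: i del: index_mult_mat(1))
  fix x assume "x < n" "x \<noteq> u" "x \<noteq> v"
  with w show "swap_conj n u v A $$ (w, x) = A $$ (w, x)"
    unfolding swap_conj_def using uv by (simp add: i del: index_mult_mat(1))
qed

section \<open>The transformation on edge relations\<close>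

definition kelmans :: "'a rel \<Rightarrow> 'a \<Rightarrow> 'a \<Rightarrow> 'a rel" where
  "kelmans E u v = (let Q = private_nbrs E v u in
     (E - ({v} \<times> Q \<union> Q \<times> {v})) \<union> ({u} \<times> Q \<union> Q \<times> {u}))"

lemma sym_kelmans: "sym E \<Longrightarrow> sym (kelmans E u v)"
  unfolding kelmans_def Let_def by (intro symI) (auto dest: symD)

text \<open>Away from \<open>u\<close> and \<open>v\<close>, moving the private neighbours gives
  \<open>u\<close> the union and \<open>v\<close> the intersection of the two neighbourhoods. This
  form fits the sums and differences of rows in the new basis.\<close>

lemma kelmans_iff:
  assumes E: "sym E" "irrefl E" and uv: "u \<noteq> v"
  shows "(u, u) \<notin> kelmans E u v" "(v, v) \<notin> kelmans E u v"
    "(u, v) \<in> kelmans E u v \<longleftrightarrow> (u, v) \<in> E" "(v, u) \<in> kelmans E u v \<longleftrightarrow> (u, v) \<in> E"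
    "w \<noteq> u \<Longrightarrow> w \<noteq> v \<Longrightarrow> (u, w) \<in> kelmans E u v \<longleftrightarrow> (u, w) \<in> E \<or> (v, w) \<in> E"
    "w \<noteq> u \<Longrightarrow> w \<noteq> v \<Longrightarrow> (w, u) \<in> kelmans E u v \<longleftrightarrow> (u, w) \<in> E \<or> (v, w) \<in> E"
    "w \<noteq> u \<Longrightarrow> w \<noteq> v \<Longrightarrow> (v, w) \<in> kelmans E u v \<longleftrightarrow> (u, w) \<in> E \<and> (v, w) \<in> E"
    "w \<noteq> u \<Longrightarrow> w \<noteq> v \<Longrightarrow> (w, v) \<in> kelmans E u v \<longleftrightarrow> (u, w) \<in> E \<and> (v, w) \<in> E"
    "w \<noteq> u \<Longrightarrow> w \<noteq> v \<Longrightarrow> x \<noteq> u \<Longrightarrow> x \<noteq> v \<Longrightarrow> (w, x) \<in> kelmans E u v \<longleftrightarrow> (w, x) \<in> E"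
  using uv symD[OF E(1)] irreflD[OF E(2)] unfolding kelmans_def private_nbrs_def Let_def by blast+

text \<open>As many pairs are added as removed, and the added ones are new because a private
  neighbour of \<open>v\<close> is not adjacent to \<open>u\<close>.\<close>

lemma card_kelmans:
  assumes E: "sym E" "irrefl E" "finite E" and uv: "u \<noteq> v"
  shows "card (kelmans E u v) = card E"
proof -
  define Q where "Q = private_nbrs E v u"
  have Q: "(v, w) \<in> E" "(w, v) \<in> E" "(u, w) \<notin> E" "(w, u) \<notin> E" "w \<noteq> u" "w \<noteq> v" if "w \<in> Q" for w
    using that E symD[OF E(1)] irreflD[OF E(2)] unfolding Q_def private_nbrs_def by auto
  have fin: "finite Q" using E(3) by (rule finite_subset[rotated, OF finite_imageI[of _ snd]]) (use Q in force)
  have card: "card ({x} \<times> Q \<union> Q \<times> {x}) = card Q + card Q" if "x \<in> {u, v}" for x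
  proof -
    have "x \<notin> Q" using Q(5,6) that by blast
    then show ?thesis using fin by (subst card_Un_disjoint) (auto simp: card_cartesian_product)
  qed
  have sub: "{v} \<times> Q \<union> Q \<times> {v} \<subseteq> E" using Q by auto
  have "card (kelmans E u v) = card (E - ({v} \<times> Q \<union> Q \<times> {v})) + card ({u} \<times> Q \<union> Q \<times> {u})"
    unfolding kelmans_def Let_def Q_def[symmetric] using fin E Q by (intro card_Un_disjoint) auto
  also have "\<dots> = card E - card ({v} \<times> Q \<union> Q \<times> {v}) + card ({u} \<times> Q \<union> Q \<times> {u})"
    using fin sub by (subst card_Diff_subset) auto
  also have "\<dots> = card E" using card_mono[OF E(3) sub] card by simp
  finally show ?thesis .
qed

text \<open>The edge between \<open>u\<close> and \<open>v\<close> and their common neighbours are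
  kept, so \<open>u\<close> and \<open>v\<close> stay connected. An edge lost at \<open>v\<close>
  reappears at \<open>u\<close> and is replaced by a detour through \<open>u\<close>.\<close>

lemma rtrancl_kelmans:
  assumes E: "sym E" "irrefl E" and uv: "u \<noteq> v"
    and near: "near E u v"
  shows "E\<^sup>* \<subseteq> (kelmans E u v)\<^sup>*"
proof -
  let ?K = "kelmans E u v"
  note iff = kelmans_iff[OF E uv]
  have "(u, v) \<in> ?K\<^sup>*"
  proof (cases "(u, v) \<in> E")
    case True
    then show ?thesis using iff by blast
  next
    case False
    then obtain y where y: "(u, y) \<in> E" "(v, y) \<in> E"
      using near unfolding near_def by blast
    then have "y \<noteq> u" "y \<noteq> v" using irreflD[OF E(2)] by auto
    with y have "(u, y) \<in> ?K" "(y, v) \<in> ?K" using iff by blast+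
    then show ?thesis by (meson r_into_rtrancl rtrancl_trans)
  qed
  moreover have "sym (?K\<^sup>*)" using sym_kelmans[OF E(1)] by (rule sym_rtrancl)
  ultimately have uv': "(u, v) \<in> ?K\<^sup>*" "(v, u) \<in> ?K\<^sup>*" by (auto dest: symD)
  have "(a, b) \<in> ?K\<^sup>*" if ab: "(a, b) \<in> E" for a b
  proof (cases "(a, b) \<in> ?K")
    case False
    then consider "a = v" "(u, b) \<in> ?K" | "b = v" "(a, u) \<in> ?K"
      using ab unfolding kelmans_def Let_def by blast
    then show ?thesis using uv' by cases (meson r_into_rtrancl rtrancl_trans)+
  qed auto
  then show ?thesis by (metis rtrancl_subset_rtrancl subrelI)
qed

text \<open>Strictness comes from walks of length two from \<open>v\<close> to \<open>u\<close> in
  the new basis: those through \<open>p\<close> and \<open>q\<close> have opposite signs before the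
  transformation and the same sign after it. The fourth power is the square of the square, so its
  trace grows strictly.\<close>

lemma EE_kelmans:
  assumes E: "sym E" "irrefl E" and uv: "u < n" "v < n" "u \<noteq> v"
    and p: "p < n" "p \<in> private_nbrs E u v" and q: "q < n" "q \<in> private_nbrs E v u"
  shows "EE n E < EE n (kelmans E u v)"
proof -
  let ?K = "kelmans E u v"
  define X where "X = swap_conj n u v (adj n E) + 1\<^sub>m n"
  define Y where "Y = swap_conj n u v (adj n ?K) + 1\<^sub>m n"
  have irr: "(a, a) \<notin> E" for a using irreflD[OF E(2)] .
  have sym: "w \<noteq> u \<Longrightarrow> (w, u) \<in> E \<longleftrightarrow> (u, w) \<in> E"
    "w \<noteq> u \<Longrightarrow> w \<noteq> v \<Longrightarrow> (w, v) \<in> E \<longleftrightarrow> (v, w) \<in> E" for w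
    using symD[OF E(1)] by blast+
  note index = swap_conj_index[OF adj_carrier uv]
  note iff = kelmans_iff[OF E uv(3)]
  have pq: "(u, p) \<in> E" "(v, p) \<notin> E" "p \<noteq> u" "p \<noteq> v" "(v, q) \<in> E" "(u, q) \<notin> E" "q \<noteq> u" "q \<noteq> v" 
    using p q irr unfolding private_nbrs_def by auto
  have XY: "X \<in> carrier_mat n n" "Y \<in> carrier_mat n n" unfolding X_def Y_def by auto
  have dims: "dim_row (swap_conj n u v A) = n" "dim_col (swap_conj n u v A) = n" for A
    using swap_conj_carrier carrier_matD by blast+
  \<comment> \<open>Union and intersection have the same sum of indicators as the two
    neighbourhoods, so entries at \<open>u\<close> stay. Their difference indicates the symmetric
    difference, so entries at \<open>v\<close> lose their sign.\<close>
  have le: "\<bar>X $$ (i, j)\<bar> \<le> Y $$ (i, j)" if "i < n" "j < n" for i j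
  proof -
    consider "i = u" "j = u" | "i = u" "j = v" | "i = u" "j \<noteq> u" "j \<noteq> v"
      | "i = v" "j = u" | "i = v" "j = v" | "i = v" "j \<noteq> u" "j \<noteq> v"
      | "i \<noteq> u" "i \<noteq> v" "j = u" | "i \<noteq> u" "i \<noteq> v" "j = v"
      | "i \<noteq> u" "i \<noteq> v" "j \<noteq> u" "j \<noteq> v" by blast
    then show ?thesis
      unfolding X_def Y_def using that uv
      by cases (auto simp: index iff irr sym dims)
  qed
  have pow2: "Z ^\<^sub>m 2 = Z * Z" if "Z \<in> carrier_mat n n" for Z :: "real mat"
    using that left_mult_one_mat[OF that] by (simp add: numeral_2_eq_2)
  have pow4: "Z ^\<^sub>m 4 = Z ^\<^sub>m 2 * Z ^\<^sub>m 2" if "Z \<in> carrier_mat n n" for Z :: "real mat"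
    using that left_mult_one_mat[OF that] by (simp add: numeral_eq_Suc assoc_mult_mat[of _ n n _ n _ n])
  have entries: "(Z ^\<^sub>m 2) $$ (i, j) = (\<Sum>w<n. Z $$ (i, w) * Z $$ (w, j))"
    if "Z \<in> carrier_mat n n" "i < n" "j < n" for Z :: "real mat" and i j
    using pow2[OF that(1)] mult_mat_index[OF that(1,1,2,3)] by simp
  have term_le: "\<bar>X $$ (a, w) * X $$ (w, b)\<bar> \<le> Y $$ (a, w) * Y $$ (w, b)" if "a < n" "w < n" "b < n" for a b w
    unfolding abs_mult using that by (intro mult_mono le order_trans[OF abs_ge_zero le] abs_ge_zero)
  have terms: "X $$ (v, p) * X $$ (p, u) = 1/2" "Y $$ (v, p) * Y $$ (p, u) = 1/2"
    "X $$ (v, q) * X $$ (q, u) = - 1/2" "Y $$ (v, q) * Y $$ (q, u) = 1/2" "Y $$ (u, p) * Y $$ (p, v) = 1/2"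
    unfolding X_def Y_def using pq p(1) q(1) uv
    by (simp_all add: index iff dims sym)
  \<comment> \<open>Here \<open>q\<close> gives strictness: its term is negative in \<open>X\<close>
    and positive in \<open>Y\<close>.\<close>
  have "(X ^\<^sub>m 2) $$ (v, u) < (Y ^\<^sub>m 2) $$ (v, u)"
    unfolding entries[OF XY(1) uv(2,1)] entries[OF XY(2) uv(2,1)]
  proof (rule sum_strict_mono_ex1)
    show "\<forall>w\<in>{..<n}. X $$ (v, w) * X $$ (w, u) \<le> Y $$ (v, w) * Y $$ (w, u)"
      using term_le uv by (meson abs_ge_self lessThan_iff order_trans)
    show "\<exists>w\<in>{..<n}. X $$ (v, w) * X $$ (w, u) < Y $$ (v, w) * Y $$ (w, u)"
      using q(1) terms by (intro bexI[of _ q]) auto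
  qed simp
  \<comment> \<open>After negation the roles change, and the positive term at \<open>p\<close> gives
    strictness.\<close>
  moreover have "- (X ^\<^sub>m 2) $$ (v, u) < (Y ^\<^sub>m 2) $$ (v, u)"
    unfolding entries[OF XY(1) uv(2,1)] entries[OF XY(2) uv(2,1)] sum_negf[symmetric]
  proof (rule sum_strict_mono_ex1)
    show "\<forall>w\<in>{..<n}. - (X $$ (v, w) * X $$ (w, u)) \<le> Y $$ (v, w) * Y $$ (w, u)"
      using term_le uv by (meson abs_ge_minus_self lessThan_iff order_trans)
    show "\<exists>w\<in>{..<n}. - (X $$ (v, w) * X $$ (w, u)) < Y $$ (v, w) * Y $$ (w, u)"
      using p(1) terms by (intro bexI[of _ p]) auto
  qed simp
  ultimately have less: "\<bar>(X ^\<^sub>m 2) $$ (v, u)\<bar> < (Y ^\<^sub>m 2) $$ (v, u)" by (simp add: abs_if)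
  \<comment> \<open>The opposite entry is positive because of the walk through
    \<open>p\<close>.\<close>
  have "0 < (Y ^\<^sub>m 2) $$ (u, v)"
    unfolding entries[OF XY(2) uv(1,2)] using terms(5) term_le[OF uv(1) _ uv(2)] p(1)
    by (intro sum_pos2[of _ p]) (auto intro: order_trans[OF abs_ge_zero])
  from mtrace_pow_double_strict_mono[OF XY le uv(2,1) less this]
  have "mtrace (X ^\<^sub>m 4) < mtrace (Y ^\<^sub>m 4)" unfolding pow4[OF XY(1)] pow4[OF XY(2)] .
  from EE_less[OF E(1) swap_conj_carrier similar_swap_conj[OF adj_carrier uv]
      sym_kelmans[OF E(1), of u v] swap_conj_carrier similar_swap_conj[OF adj_carrier uv],
      folded X_def Y_def, OF le this]
  show ?thesis .
qed

section \<open>The extremal graph\<close>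

text \<open>Relabelling conjugates the adjacency matrix by the permutation matrix of
  \<open>f\<close>.\<close>

lemma EE_bij:
  assumes f: "bij_betw f {..<n} {..<n}"
    and E: "\<And>i j. i < n \<Longrightarrow> j < n \<Longrightarrow> (i, j) \<in> E \<longleftrightarrow> (f i, f j) \<in> E'"
  shows "EE n E = EE n E'"
proof -
  define P where "P = mat n n (\<lambda>(i, j). of_bool (i = f j) :: real)"
  define Q where "Q = mat n n (\<lambda>(i, j). of_bool (j = f i) :: real)"
  have PQ: "P \<in> carrier_mat n n" "Q \<in> carrier_mat n n" by (auto simp: P_def Q_def)
  have lt: "f i < n" if "i < n" for i using f that bij_betwE by blast
  have inj: "f i = f j \<longleftrightarrow> i = j" if "i < n" "j < n" for i j
    using f that unfolding bij_betw_def by (auto dest: inj_onD)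
  have Q_mult: "(Q * B) $$ (i, j) = B $$ (f i, j)" if B: "B \<in> carrier_mat n n" and ij: "i < n" "j < n" for B i j
    unfolding mult_mat_index[OF PQ(2) B ij] using ij lt by (simp add: Q_def sum_delta_of_bool)
  have mult_P: "(B * P) $$ (i, j) = B $$ (i, f j)" if B: "B \<in> carrier_mat n n" and ij: "i < n" "j < n" for B i j
    unfolding mult_mat_index[OF B PQ(1) ij] using ij lt by (simp add: P_def sum_delta_of_bool)
  have QP: "Q * P = 1\<^sub>m n"
  proof (rule eq_matI)
    fix i j assume "i < dim_row (1\<^sub>m n :: real mat)" "j < dim_col (1\<^sub>m n :: real mat)"
    then show "(Q * P) $$ (i, j) = 1\<^sub>m n $$ (i, j)"
      using Q_mult[OF PQ(1)] lt inj by (simp add: P_def del: index_mult_mat(1))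
  qed (use PQ in auto)
  have "Q * adj n E' * P = adj n E"
  proof (rule eq_matI)
    fix i j assume "i < dim_row (adj n E)" "j < dim_col (adj n E)"
    then have ij: "i < n" "j < n" by (auto simp: adj_def)
    have "Q * adj n E' \<in> carrier_mat n n" using PQ by (intro mult_carrier_mat[of _ n n]) auto
    then show "(Q * adj n E' * P) $$ (i, j) = adj n E $$ (i, j)"
      using ij lt E by (simp add: mult_P Q_mult[OF adj_carrier] del: index_mult_mat(1))
  qed (use PQ in \<open>auto simp: adj_def\<close>)
  then have "similar_mat (adj n E) (adj n E')"
    using PQ QP mat_mult_left_right_inverse[OF PQ(2,1) QP] by (intro similar_matI[of _ _ Q P n]) auto
  then show ?thesis unfolding EE_def using char_poly_similar by metis
qed

text \<open>The fixed vertex set \<open>{..<n}\<close> leaves finitely many candidates, so a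
  maximiser exists. The factor 2 counts both orientations of the \<open>n + 1\<close> edges.\<close>

definition bicyclic_rels :: "nat \<Rightarrow> nat rel set" where
  "bicyclic_rels n = {E. E \<subseteq> {..<n} \<times> {..<n} \<and> sym E \<and> irrefl E \<and> card E = 2 * (n + 1) \<and>
     (\<forall>i<n. \<forall>j<n. (i, j) \<in> E\<^sup>*)}"

lemma kelmans_bicyclic_rels:
  assumes E: "E \<in> bicyclic_rels n" and uv: "u \<noteq> v" "near E u v"
  shows "kelmans E u v \<in> bicyclic_rels n"
proof -
  have *: "E \<subseteq> {..<n} \<times> {..<n}" "sym E" "irrefl E" "card E = 2 * (n + 1)" "\<forall>i<n. \<forall>j<n. (i, j) \<in> E\<^sup>*"
    using E unfolding bicyclic_rels_def by auto
  have "finite E" using *(1) by (rule finite_subset) simp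
  have "u < n" "v < n" using uv(2) *(1) symD[OF *(2)] unfolding near_def by blast+
  then have "kelmans E u v \<subseteq> {..<n} \<times> {..<n}"
    using *(1) unfolding kelmans_def Let_def private_nbrs_def by auto
  moreover have "irrefl (kelmans E u v)"
    using irreflD[OF *(3)] unfolding kelmans_def Let_def private_nbrs_def irrefl_def by auto
  moreover have "\<forall>i<n. \<forall>j<n. (i, j) \<in> (kelmans E u v)\<^sup>*"
    using *(5) rtrancl_kelmans[OF *(2,3) uv] by blast
  ultimately show ?thesis
    using *(4) sym_kelmans[OF *(2)] card_kelmans[OF *(2,3) \<open>finite E\<close> uv(1)]
    unfolding bicyclic_rels_def by simp
qed

text \<open>Two vertices at distance at most two with private neighbours on both sides would allow a
  transformation that stays in the class and increases \<open>EE\<close>. So the neighbourhoods of a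
  maximiser are nested.\<close>

lemma book_of_maximal:
  assumes E: "E \<in> bicyclic_rels n" and max: "\<And>E'. E' \<in> bicyclic_rels n \<Longrightarrow> EE n E' \<le> EE n E"
  shows "book {..<n} E"
proof -
  have *: "E \<subseteq> {..<n} \<times> {..<n}" "sym E" "irrefl E" "card E = 2 * (n + 1)" "\<forall>i<n. \<forall>j<n. (i, j) \<in> E\<^sup>*"
    using E unfolding bicyclic_rels_def by auto
  show ?thesis
  proof (rule book_of_nested[OF *(1-3)])
    fix u v assume uv: "u \<noteq> v" "near E u v"
    show "private_nbrs E u v = {} \<or> private_nbrs E v u = {}"
    proof (rule ccontr)
      assume "\<not> ?thesis"
      then obtain p q where pq: "p \<in> private_nbrs E u v" "q \<in> private_nbrs E v u" by blast
      then have "u < n" "v < n" "p < n" "q < n" using *(1) unfolding private_nbrs_def by auto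
      then have "EE n E < EE n (kelmans E u v)" using EE_kelmans[OF *(2,3) _ _ uv(1)] pq by blast
      then show False using max[OF kelmans_bicyclic_rels[OF E uv]] by simp
    qed
  qed (use * in auto)
qed

section \<open>Passage between graphs and relations on positions\<close>

definition index_rel :: "('a, 'b) pre_digraph \<Rightarrow> nat rel" where
  "index_rel G = {(i, j). i \<in> {..<card (verts G)} \<and> j \<in> {..<card (verts G)} \<and>
     (vertex_list G ! i, vertex_list G ! j) \<in> arcs_ends G}"

lemma bij_vertex_list:
  assumes "finite (verts G)"
  shows "bij_betw (\<lambda>i. vertex_list G ! i) {..<card (verts G)} (verts G)"
proof -
  have "distinct (vertex_list G) \<and> set (vertex_list G) = verts G"
    unfolding vertex_list_def by (rule someI_ex) (use finite_distinct_list[OF assms] in blast)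
  then show ?thesis using bij_betw_nth[of "vertex_list G" "{..<card (verts G)}"] distinct_card by force
qed

text \<open>Both sides number the vertices by \<open>vertex_list\<close>, so the two matrices are
  equal and not merely similar.\<close>

lemma estrada_index_eq_EE: "estrada_index G = EE (card (verts G)) (index_rel G)"
proof -
  have "adjacency_mat G = adj (card (verts G)) (index_rel G)"
    by (rule eq_matI) (auto simp: adjacency_mat_def adj_def index_rel_def)
  then show ?thesis unfolding estrada_index_def graph_eigenvalues_def EE_def by simp
qed

lemma index_rel_bicyclic:
  assumes "bicyclic G"
  shows "index_rel G \<in> bicyclic_rels (card (verts G))"
proof -
  interpret graph G using assms by (simp add: bicyclic_def)
  let ?n = "card (verts G)" and ?E = "index_rel G"
  define f where "f = (\<lambda>i. vertex_list G ! i)"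
  have f: "bij_betw f {..<?n} (verts G)" using bij_vertex_list[OF finite_verts] unfolding f_def .
  have E: "?E = {(i, j). i \<in> {..<?n} \<and> j \<in> {..<?n} \<and> (f i, f j) \<in> arcs_ends G}"
    unfolding index_rel_def f_def ..
  have sym: "sym (arcs_ends G)" using sym_arcs by (simp add: symmetric_def)
  have irr: "irrefl (arcs_ends G)" by (auto simp: irrefl_def dest: adj_not_same)
  have fin: "finite (arcs_ends G)" by (simp add: arcs_ends_def)
  have sub: "arcs_ends G \<subseteq> verts G \<times> verts G" by (auto dest: adj_in_verts)
  have inj: "inj_on f {..<?n}" and img: "f ` {..<?n} = verts G" using f by (auto simp: bij_betw_def)
  \<comment> \<open>Counting is transferred along the enumeration: pairs of positions correspond to
    ordered pairs of adjacent vertices, two for each undirected edge.\<close>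
  have "map_prod f f ` ?E = arcs_ends G"
  proof
    show "arcs_ends G \<subseteq> map_prod f f ` ?E"
    proof clarify
      fix u v assume uv: "u \<rightarrow>\<^bsub>G\<^esub> v"
      then have "u \<in> f ` {..<?n}" "v \<in> f ` {..<?n}" unfolding img using sub by blast+
      then obtain i j where "i < ?n" "j < ?n" "u = f i" "v = f j" by blast
      then show "(u, v) \<in> map_prod f f ` ?E" using uv unfolding E by auto
    qed
  qed (auto simp: E)
  moreover have "inj_on (map_prod f f) ?E"
    using map_prod_inj_on[OF inj inj] by (rule inj_on_subset) (auto simp: E)
  ultimately have "card ?E = card (arcs_ends G)" using card_image by fastforce
  also have "\<dots> = 2 * card ((\<lambda>(u, v). {u, v}) ` arcs_ends G)"
    by (rule card_sym_irrefl_eq_double[OF fin sym irr])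
  also have "(\<lambda>(u, v). {u, v}) ` arcs_ends G = uedges G"
    unfolding uedges_def arcs_ends_def arc_to_ends_def image_image by simp
  finally have card: "card ?E = 2 * (?n + 1)" using assms by (simp add: bicyclic_def)
  \<comment> \<open>The map \<open>g\<close> recovers positions and carries walks of
    \<open>G\<close> to walks of \<open>index_rel G\<close>.\<close>
  define g where "g = the_inv_into {..<?n} f"
  have g: "g (f i) = i" if "i < ?n" for i using the_inv_into_f_f[OF inj] that unfolding g_def by simp
  have step: "(g u, g v) \<in> ?E" if "u \<rightarrow>\<^bsub>G\<^esub> v" for u v
  proof -
    have "u \<in> f ` {..<?n}" "v \<in> f ` {..<?n}" unfolding img using sub that by blast+
    then obtain i j where "i < ?n" "j < ?n" "u = f i" "v = f j" by blast
    then show ?thesis using that g unfolding E by auto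
  qed
  have "(i, j) \<in> ?E\<^sup>*" if "i < ?n" "j < ?n" for i j
  proof -
    \<comment> \<open>Connectedness is defined through the symmetrised digraph, whose reachability
      agrees with that of \<open>G\<close> since the arcs are symmetric.\<close>
    have "strongly_connected (mk_symmetric G)" using assms by (simp add: bicyclic_def connected_def)
    moreover have "f i \<in> verts G" "f j \<in> verts G" using that img by auto
    ultimately have "f i \<rightarrow>\<^sup>*\<^bsub>mk_symmetric G\<^esub> f j" unfolding strongly_connected_def by simp
    then have "f i \<rightarrow>\<^sup>*\<^bsub>G\<^esub> f j" using reachable_mk_symmetric_eq[OF sym_arcs] by simp
    then have "(g (f i), g (f j)) \<in> ?E\<^sup>*"
      by (induction rule: reachable_induct) (auto intro: rtrancl_into_rtrancl step)
    then show ?thesis using g that by simp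
  qed
  moreover have "sym ?E" "irrefl ?E" "?E \<subseteq> {..<?n} \<times> {..<?n}"
    using symD[OF sym] irreflD[OF irr] unfolding E by (auto intro!: symI simp: irrefl_def)
  ultimately show ?thesis using card unfolding bicyclic_rels_def by blast
qed

text \<open>An isomorphism of digraphs must also map arcs. Here the arc map is induced by the vertex
  map, and it is injective because \<open>G\<close> has no parallel arcs.\<close>

lemma digraph_iso_pairI:
  assumes "graph G" and f: "bij_betw f (verts G) (pverts H)"
    and sub: "parcs H \<subseteq> pverts H \<times> pverts H"
    and iff: "\<And>u v. u \<in> verts G \<Longrightarrow> v \<in> verts G \<Longrightarrow> u \<rightarrow>\<^bsub>G\<^esub> v \<longleftrightarrow> (f u, f v) \<in> parcs H"
  shows "digraph_iso G (with_proj H)"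
proof -
  interpret graph G by fact
  define h where "h = \<lparr>iso_verts = f, iso_arcs = (\<lambda>e. (f (tail G e), f (head G e))),
    iso_head = snd, iso_tail = fst\<rparr>"
  have inj: "inj_on f (verts G)" and img: "f ` verts G = pverts H" using f by (auto simp: bij_betw_def)
  have "inj_on (\<lambda>e. (f (tail G e), f (head G e))) (arcs G)"
    using inj_onD[OF inj] no_multi_arcs by (auto simp: inj_on_def arc_to_ends_def)
  then have "digraph_isomorphism h"
    unfolding digraph_isomorphism_def h_def using inj wf_digraph_axioms by auto
  moreover have "(\<lambda>e. (f (tail G e), f (head G e))) ` arcs G = parcs H"
  proof
    show "(\<lambda>e. (f (tail G e), f (head G e))) ` arcs G \<subseteq> parcs H"
    proof clarify
      fix e assume e: "e \<in> arcs G"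
      then have "tail G e \<rightarrow>\<^bsub>G\<^esub> head G e" by (rule in_arcs_imp_in_arcs_ends)
      then show "(f (tail G e), f (head G e)) \<in> parcs H" using iff e by simp
    qed
    show "parcs H \<subseteq> (\<lambda>e. (f (tail G e), f (head G e))) ` arcs G"
    proof clarify
      fix x y assume xy: "(x, y) \<in> parcs H"
      then obtain u v where uv: "u \<in> verts G" "v \<in> verts G" "x = f u" "y = f v" using sub img by blast
      then have "u \<rightarrow>\<^bsub>G\<^esub> v" using iff xy by simp
      then obtain e where "e \<in> arcs G" "tail G e = u" "head G e = v"
        by (auto simp: arcs_ends_def arc_to_ends_def)
      then show "(x, y) \<in> (\<lambda>e. (f (tail G e), f (head G e))) ` arcs G" using uv by auto
    qed
  qed
  then have "with_proj H = app_iso h G"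
    using img by (intro pre_digraph.equality) (simp_all add: h_def)
  ultimately show ?thesis unfolding digraph_iso_def by blast
qed

text \<open>Composing the vertex bijection with the two enumerations gives a permutation of
  positions, to which \<open>EE_bij\<close> applies.\<close>

lemma estrada_index_bij:
  assumes fin: "finite (verts G)" and f: "bij_betw f (verts G) (verts H)"
    and iff: "\<And>u v. u \<in> verts G \<Longrightarrow> v \<in> verts G \<Longrightarrow> u \<rightarrow>\<^bsub>G\<^esub> v \<longleftrightarrow> f u \<rightarrow>\<^bsub>H\<^esub> f v"
  shows "estrada_index G = estrada_index H"
proof -
  let ?n = "card (verts G)"
  have n: "card (verts H) = ?n" using bij_betw_same_card[OF f] by simp
  have finH: "finite (verts H)" using bij_betw_finite[OF f] fin by simp
  define a where "a = (\<lambda>i. vertex_list G ! i)"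
  define b where "b = (\<lambda>i. vertex_list H ! i)"
  have a: "bij_betw a {..<?n} (verts G)" and b: "bij_betw b {..<?n} (verts H)"
    using bij_vertex_list[OF fin] bij_vertex_list[OF finH] unfolding a_def b_def n .
  define h where "h = (\<lambda>i. the_inv_into {..<?n} b (f (a i)))"
  have h: "bij_betw h {..<?n} {..<?n}"
    using bij_betw_trans[OF bij_betw_trans[OF a f] bij_betw_the_inv_into[OF b]]
    unfolding h_def comp_def .
  have bh: "b (h i) = f (a i)" "h i < ?n" "a i \<in> verts G" if "i < ?n" for i
  proof -
    show a_i: "a i \<in> verts G" using a that bij_betwE by blast
    then have "f (a i) \<in> b ` {..<?n}" using f b by (auto simp: bij_betw_def)
    then show "b (h i) = f (a i)" using b unfolding h_def bij_betw_def by (intro f_the_inv_into_f) auto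
    show "h i < ?n" using h that bij_betwE by blast
  qed
  have "EE ?n (index_rel G) = EE ?n (index_rel H)"
  proof (rule EE_bij[OF h])
    fix i j assume ij: "i < ?n" "j < ?n"
    have "(i, j) \<in> index_rel G \<longleftrightarrow> a i \<rightarrow>\<^bsub>G\<^esub> a j" using ij by (simp add: index_rel_def a_def)
    also have "\<dots> \<longleftrightarrow> b (h i) \<rightarrow>\<^bsub>H\<^esub> b (h j)" using iff bh ij by simp
    also have "\<dots> \<longleftrightarrow> (h i, h j) \<in> index_rel H" using bh ij n by (simp add: index_rel_def b_def)
    finally show "(i, j) \<in> index_rel G \<longleftrightarrow> (h i, h j) \<in> index_rel H" .
  qed
  then show ?thesis unfolding estrada_index_eq_EE n .
qed

text \<open>The adjacent pairs of the target are the images of those of \<open>G\<close>, and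
  injectivity on the vertices reflects adjacency.\<close>

lemma estrada_index_iso:
  assumes "finite (verts G)" "digraph_iso G H"
  shows "estrada_index G = estrada_index H"
proof -
  obtain h where h: "pre_digraph.digraph_isomorphism G h" "H = app_iso h G"
    using assms(2) unfolding digraph_iso_def by blast
  note hd = h(1)[unfolded pre_digraph.digraph_isomorphism_def]
  interpret wf_digraph G using hd by blast
  have inj: "inj_on (iso_verts h) (verts G)" using hd by blast
  have ends: "iso_tail h (iso_arcs h e) = iso_verts h (tail G e)" "iso_head h (iso_arcs h e) = iso_verts h (head G e)"
    if "e \<in> arcs G" for e using hd that by auto
  show ?thesis
  proof (rule estrada_index_bij[OF assms(1)])
    show "bij_betw (iso_verts h) (verts G) (verts H)" using inj by (simp add: bij_betw_def h(2))
    fix u v assume uv: "u \<in> verts G" "v \<in> verts G"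
    have ends_H: "arcs_ends H = (\<lambda>e. (iso_verts h (tail G e), iso_verts h (head G e))) ` arcs G"
      unfolding h(2) arcs_ends_def arc_to_ends_def by (auto simp: image_image ends)
    have eq: "iso_verts h a = iso_verts h b \<longleftrightarrow> a = b" if "a \<in> verts G" "b \<in> verts G" for a b
      using inj that by (rule inj_on_eq_iff)
    have "iso_verts h u \<rightarrow>\<^bsub>H\<^esub> iso_verts h v \<longleftrightarrow>
        (\<exists>e\<in>arcs G. iso_verts h u = iso_verts h (tail G e) \<and> iso_verts h v = iso_verts h (head G e))"
      unfolding ends_H by blast
    also have "\<dots> \<longleftrightarrow> (\<exists>e\<in>arcs G. u = tail G e \<and> v = head G e)"
      by (intro bex_cong refl) (simp add: eq uv)
    also have "\<dots> \<longleftrightarrow> u \<rightarrow>\<^bsub>G\<^esub> v"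
      unfolding arcs_ends_def arc_to_ends_def by blast
    finally show "u \<rightarrow>\<^bsub>G\<^esub> v \<longleftrightarrow> iso_verts h u \<rightarrow>\<^bsub>H\<^esub> iso_verts h v" ..
  qed
qed

section \<open>The graph \<open>G1\<close> as a book and as the maximiser\<close>

lemma G1_book:
  assumes x: "x \<in> {Source, Sink}"
  shows "book (pverts (G1 x n)) (parcs (G1 x n))"
proof -
  \<comment> \<open>The other vertex of degree 3 takes the role of \<open>a\<close> in
    \<open>book\<close>, while \<open>x\<close>, which carries the pendant edges, is the dominating
    vertex.\<close>
  define y where "y = (if x = Source then Sink else Source)"
  have V: "pverts (G1 x n) = Inl ` {x, y, Inner 0 1, Inner 1 1} \<union> Inr ` {..<n - 4}"
    using x unfolding G1_def attach_pendants_def pverts_theta_2_2_1 y_def by auto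
  have A: "parcs (G1 x n) = (\<lambda>(u, v). (Inl u, Inl v)) ` {(x, y), (y, x), (x, Inner 1 1), (Inner 1 1, x),
      (Inner 1 1, y), (y, Inner 1 1), (x, Inner 0 1), (Inner 0 1, x), (Inner 0 1, y), (y, Inner 0 1)}
      \<union> (\<Union>i<n - 4. {(Inl x, Inr i), (Inr i, Inl x)})"
    using x unfolding G1_def attach_pendants_def parcs_theta_2_2_1 y_def by auto
  have d: "distinct [x, y, Inner 0 1, Inner 1 1]" using x unfolding y_def by auto
  show ?thesis
    unfolding book_def
  proof (intro exI conjI)
    show "distinct [Inl x :: theta_vertex + nat, Inl y, Inl (Inner 0 1), Inl (Inner 1 1)]" using d by simp
    show "{Inl x, Inl y, Inl (Inner 0 1), Inl (Inner 1 1)} \<subseteq> pverts (G1 x n)" unfolding V by auto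
    show "parcs (G1 x n) = {(u, v). u \<in> pverts (G1 x n) \<and> v \<in> pverts (G1 x n) \<and> u \<noteq> v \<and>
        (u = Inl x \<or> v = Inl x \<or> {u, v} = {Inl y, Inl (Inner 0 1)} \<or> {u, v} = {Inl y, Inl (Inner 1 1)})}"
      unfolding V A using d by (auto simp: doubleton_eq_iff)
  qed
qed

theorem theorem3p8:
  fixes G :: "('a, 'b) pre_digraph" and n :: nat and x :: theta_vertex
  assumes "bicyclic G" and "card (verts G) = n"
    and "x \<in> verts (theta 2 2 1)" and "out_degree (theta 2 2 1) x = 3"
  shows "estrada_index G \<le> estrada_index (G1 x n)
    \<and> (estrada_index G = estrada_index (G1 x n) \<longleftrightarrow> digraph_iso G (G1 x n))"
proof -
  interpret graph G using assms(1) by (simp add: bicyclic_def)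
  have x: "x \<in> {Source, Sink}" using assms(3,4) out_degree_theta_2_2_1 by simp
  let ?S = "bicyclic_rels n" and ?H = "with_proj (G1 x n)"
  have G: "index_rel G \<in> ?S" using index_rel_bicyclic[OF assms(1)] assms(2) by simp
  have "?S \<subseteq> Pow ({..<n} \<times> {..<n})" by (auto simp: bicyclic_rels_def)
  then have "finite ?S" by (rule finite_subset) simp
  \<comment> \<open>The class is nonempty because it contains the relation of
    \<open>G\<close>.\<close>
  then have "Max (EE n ` ?S) \<in> EE n ` ?S" using G by (intro Max_in) auto
  then obtain M where M: "M \<in> ?S" "\<And>E. E \<in> ?S \<Longrightarrow> EE n E \<le> EE n M"
    using \<open>finite ?S\<close> by (metis (no_types, lifting) Max_ge finite_imageI image_eqI imageE)
  have bookM: "book {..<n} M" using book_of_maximal[OF M] .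
  then obtain z a b c where zabc: "distinct [z, a, b, c]" "{z, a, b, c} \<subseteq> {..<n}"
    unfolding book_def by blast
  \<comment> \<open>The bound on the order is read off from the four distinguished vertices of the
    maximiser.\<close>
  have n: "n \<ge> 4" using card_mono[OF _ zabc(2)] distinct_card[OF zabc(1)] by simp
  have cardH: "card (verts ?H) = n" using bicyclic_G1(2)[OF x n] .
  \<comment> \<open>An infinite set has cardinality 0, which \<open>n \<ge> 4\<close> rules
    out.\<close>
  have finH: "finite (verts ?H)" using cardH n by (metis card.infinite not_numeral_le_zero)
  have "arcs_ends ?H = parcs (G1 x n)" by (simp add: arcs_ends_def arc_to_ends_def)
  then have bookH: "book (verts ?H) (arcs_ends ?H)" using G1_book[OF x] by simp
  have H: "book {..<n} (index_rel ?H)"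
    using book_pullback[OF bookH bij_vertex_list[OF finH]] cardH unfolding index_rel_def by simp
  \<comment> \<open>All books on \<open>n\<close> vertices are isomorphic and share one value of
    \<open>EE\<close>, so \<open>G1\<close> attains the maximum found at \<open>M\<close>.\<close>
  have EE_book: "EE n E = EE n (index_rel ?H)" if book: "book {..<n} E" for E
    using book_iso[OF book H] EE_bij by fastforce
  have max: "estrada_index ?H = EE n M"
    unfolding estrada_index_eq_EE cardH using EE_book[OF bookM] by simp
  have "estrada_index G \<le> estrada_index ?H"
    using M(2)[OF G] max estrada_index_eq_EE[of G] assms(2) by simp
  moreover have "digraph_iso G ?H" if eq: "estrada_index G = estrada_index ?H"
  proof -
    \<comment> \<open>Equality makes \<open>index_rel G\<close> a maximiser as well, hence a book,
      and two books of equal order are isomorphic.\<close>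
    have "EE n (index_rel G) = EE n M" using eq max estrada_index_eq_EE[of G] assms(2) by simp
    then have "book {..<n} (index_rel G)" using M(2) G by (intro book_of_maximal) auto
    \<comment> \<open>The map \<open>g\<close> sends a vertex to its position; pulling back along it
      returns the book structure to the vertices of \<open>G\<close>.\<close>
    define g where "g = the_inv_into {..<n} ((!) (vertex_list G))"
    have bij: "bij_betw g (verts G) {..<n}"
      using bij_betw_the_inv_into[OF bij_vertex_list[OF finite_verts]] assms(2) unfolding g_def by simp
    have inv: "vertex_list G ! g u = u" if "u \<in> verts G" for u
      using bij_vertex_list[OF finite_verts] that assms(2) unfolding g_def
      by (intro f_the_inv_into_f) (auto simp: bij_betw_def)
    have "(g u, g v) \<in> index_rel G \<longleftrightarrow> u \<rightarrow>\<^bsub>G\<^esub> v" if "u \<in> verts G" "v \<in> verts G" for u v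
      using inv that bij_betwE[OF bij] assms(2) by (simp add: index_rel_def)
    then have "{(u, v). u \<in> verts G \<and> v \<in> verts G \<and> (g u, g v) \<in> index_rel G} = arcs_ends G"
      by (auto dest: adj_in_verts)
    then have "book (verts G) (arcs_ends G)"
      using book_pullback[OF \<open>book {..<n} (index_rel G)\<close> bij] by simp
    then obtain f where f: "bij_betw f (verts G) (verts ?H)"
      "\<And>u v. u \<in> verts G \<Longrightarrow> v \<in> verts G \<Longrightarrow> u \<rightarrow>\<^bsub>G\<^esub> v \<longleftrightarrow> f u \<rightarrow>\<^bsub>?H\<^esub> f v"
      using book_iso[OF _ bookH finite_verts finH] assms(2) cardH by metis
    show ?thesis
    proof (rule digraph_iso_pairI[OF graph_axioms])
      show "bij_betw f (verts G) (pverts (G1 x n))" using f(1) by simp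
      show "parcs (G1 x n) \<subseteq> pverts (G1 x n) \<times> pverts (G1 x n)"
        using G1_book[OF x, of n] unfolding book_def by (elim exE conjE) (simp only:, auto)
    qed (use f(2) \<open>arcs_ends ?H = parcs (G1 x n)\<close> in simp)
  qed
  moreover have "estrada_index G = estrada_index ?H" if "digraph_iso G ?H"
    using estrada_index_iso[OF finite_verts that] .
  ultimately show ?thesis by blast
qed

end
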